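(* Let $\Delta$ be a rank 2 root system of type $H(a,b)$ with $a\ge b$ and $ab\ge4$. Let $\Gamma\subseteq\Delta^{\mathrm{re}}$ be nonempty. (i) If $a>4$, $b=1$ and $\Phi(\Gamma)$ is the subsystem consisting of all short roots in $\Delta^{\mathrm{re}}$, then $\Delta^{\mathrm{re}}(\Gamma)=\Delta^{\mathrm{re}}\ne\Phi(\Gamma)$. (ii) If $a=4$, $b=1$ and $\Phi(\Gamma)$ is a subsystem of type $\mathrm{II}_S$ with basis $\alpha^{SU}_r,\alpha^{SL}_{d-r-1}$ for some odd $d=2e+1$ and $0\le r<d$, then $\Delta^{\mathrm{re}}(\Gamma)\ne\Phi(\Gamma)$ and $\Delta^{\mathrm{re}}(\Gamma)$ is a subsystem of type $\mathrm{II}_{LS}$ with basis $\alpha^{LL}_s,\alpha^{SU}_{e-s}$, where $s\equiv e-r \pmod d$ and $-e\le s\le e$. (iii) In all other cases, $\Delta^{\mathrm{re}}(\Gamma)=\Phi(\Gamma)$.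
   Context: $\Delta$ is the root system of the Kac--Moody algebra with generalized Cartan matrix $\begin{pmatrix}2&-b\\-a&2\end{pmatrix}$, $a,b$ positive integers. Simple roots are $\alpha_1,\alpha_2$; simple reflections $w_1(\alpha_1)=-\alpha_1$, $w_1(\alpha_2)=\alpha_2+b\alpha_1$, $w_2(\alpha_1)=\alpha_1+a\alpha_2$, $w_2(\alpha_2)=-\alpha_2$; $W=\langle w_1,w_2\rangle$; symmetric bilinear form $(\alpha_1,\alpha_1)=2a/b$, $(\alpha_1,\alpha_2)=-a$, $(\alpha_2,\alpha_2)=2$; real roots $\Delta^{\mathrm{re}}=W\alpha_1\cup W\alpha_2$. If $a>b$, roots in $W\alpha_1$ are long and those in $W\alpha_2$ are short; if $a=b$ all real roots are called long. For $j\in\mathbb Z$: $\alpha^{LL}_j=(w_1w_2)^j\alpha_1$, $\alpha^{LU}_j=(w_2w_1)^jw_2\alpha_1$, $\alpha^{SU}_j=(w_2w_1)^j\alpha_2$, $\alpha^{SL}_j=(w_1w_2)^jw_1\alpha_2$. For a real root $\alpha$, $w_\alpha(\beta)=\beta-\frac{2(\beta,\alpha)}{(\alpha,\alpha)}\alpha$. For $\Gamma\subseteq\Delta^{\mathrm{re}}$: $W_\Gamma=\langle w_\alpha:\alpha\in\Gamma\rangle$, $\Phi(\Gamma)=W_\Gamma\cdot\Gamma$ (sets of this form are $\Phi$-subsystems), and $\Delta^{\mathrm{re}}(\Gamma)=\mathbb Z\Gamma\cap\Delta^{\mathrm{re}}$. A $\Phi$-subsystem $\Psi$ has basis $\beta_1,\beta_2$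 (elements of $\Psi$, not required to be positive in $\Delta$) if $\Psi=W_{\{\beta_1,\beta_2\}}\cdot\{\beta_1,\beta_2\}$ and every element of $\Psi$ is a nonnegative or nonpositive integer combination of $\beta_1,\beta_2$. It is of type $\mathrm{II}_S$ if it has a basis $\alpha^{SU}_r,\alpha^{SL}_{d-r-1}$ with $d>0$, $0\le r<d$, and of type $\mathrm{II}_{LS}$ if it has a basis $\alpha^{LL}_r,\alpha^{SU}_{d-r}$ with $d\ge0$, $-d\le r\le d$. *)

theory Defs
  imports
    "HOL-Analysis.Product_Vector"
    "HOL-Algebra.Generated_Groups"
    "HOL-Algebra.Bij"
    "HOL-Computational_Algebra.Group_Closure"
    "HOL-Number_Theory.Cong"
begin

text \<open>
  The rank 2 root system of type \<open>H(a,b)\<close>: the root system of the Kac--Moody algebra with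
  generalized Cartan matrix with rows \<open>(2, -b)\<close> and \<open>(-a, 2)\<close>. Roots live in the real vector
  space with basis \<open>\<alpha>\<^sub>1, \<alpha>\<^sub>2\<close>, identified with pairs of coordinates.
\<close>

definition alpha1 :: "real \<times> real" where "alpha1 = (1, 0)"

definition alpha2 :: "real \<times> real" where "alpha2 = (0, 1)"

definition w1 :: "nat \<Rightarrow> real \<times> real \<Rightarrow> real \<times> real" where
  "w1 b v = fst v *\<^sub>R (- alpha1) + snd v *\<^sub>R (alpha2 + real b *\<^sub>R alpha1)"

definition w2 :: "nat \<Rightarrow> real \<times> real \<Rightarrow> real \<times> real" where
  "w2 a v = fst v *\<^sub>R (alpha1 + real a *\<^sub>R alpha2) + snd v *\<^sub>R (- alpha2)"

text \<open>
  The group generated by a set of bijections of the root space, as a subgroup of the group of all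
  bijections. (In \<^const>\<open>BijGroup\<close> the product of maps that are not bijective is
  unspecified; the reflections used below are all bijective.)
\<close>

abbreviation root_space_Bij :: "(real \<times> real \<Rightarrow> real \<times> real) monoid" where
  "root_space_Bij \<equiv> BijGroup UNIV"

abbreviation group_gen ::
    "(real \<times> real \<Rightarrow> real \<times> real) set \<Rightarrow> (real \<times> real \<Rightarrow> real \<times> real) set" where
  "group_gen S \<equiv> generate root_space_Bij S"

definition weyl_group :: "nat \<Rightarrow> nat \<Rightarrow> (real \<times> real \<Rightarrow> real \<times> real) set" where
  "weyl_group a b = group_gen {w1 b, w2 a}"

definition orbit ::
    "(real \<times> real \<Rightarrow> real \<times> real) set \<Rightarrow> (real \<times> real) set \<Rightarrow> (real \<times> real) set" where
  "orbit G S = {g v | g v. g \<in> G \<and> v \<in> S}"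

text \<open>
  The symmetric bilinear form with
  \<open>(\<alpha>\<^sub>1,\<alpha>\<^sub>1) = 2a/b\<close>, \<open>(\<alpha>\<^sub>1,\<alpha>\<^sub>2) = -a\<close>, \<open>(\<alpha>\<^sub>2,\<alpha>\<^sub>2) = 2\<close>.
\<close>

definition bform :: "nat \<Rightarrow> nat \<Rightarrow> real \<times> real \<Rightarrow> real \<times> real \<Rightarrow> real" where
  "bform a b u v =
     (2 * real a / real b) * (fst u * fst v)
     - real a * (fst u * snd v + snd u * fst v)
     + 2 * (snd u * snd v)"

definition real_roots :: "nat \<Rightarrow> nat \<Rightarrow> (real \<times> real) set" where
  "real_roots a b = orbit (weyl_group a b) {alpha1} \<union> orbit (weyl_group a b) {alpha2}"

text \<open>
  For \<open>a > b\<close> the short roots are those in \<open>W\<alpha>\<^sub>2\<close>; for \<open>a = b\<close> all real roots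
  are long. (Only \<open>a \<ge> b\<close> is considered.)
\<close>

definition short_roots :: "nat \<Rightarrow> nat \<Rightarrow> (real \<times> real) set" where
  "short_roots a b = (if a > b then orbit (weyl_group a b) {alpha2} else {})"

definition root_LL :: "nat \<Rightarrow> nat \<Rightarrow> int \<Rightarrow> real \<times> real" where
  "root_LL a b j = ((w1 b \<circ> w2 a) [^]\<^bsub>root_space_Bij\<^esub> j) alpha1"

definition root_SU :: "nat \<Rightarrow> nat \<Rightarrow> int \<Rightarrow> real \<times> real" where
  "root_SU a b j = ((w2 a \<circ> w1 b) [^]\<^bsub>root_space_Bij\<^esub> j) alpha2"

definition root_SL :: "nat \<Rightarrow> nat \<Rightarrow> int \<Rightarrow> real \<times> real" where
  "root_SL a b j = ((w1 b \<circ> w2 a) [^]\<^bsub>root_space_Bij\<^esub> j) (w1 b alpha2)"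

definition refl :: "nat \<Rightarrow> nat \<Rightarrow> real \<times> real \<Rightarrow> real \<times> real \<Rightarrow> real \<times> real" where
  "refl a b \<alpha> \<beta> = \<beta> - (2 * bform a b \<beta> \<alpha> / bform a b \<alpha> \<alpha>) *\<^sub>R \<alpha>"

definition refl_group ::
    "nat \<Rightarrow> nat \<Rightarrow> (real \<times> real) set \<Rightarrow> (real \<times> real \<Rightarrow> real \<times> real) set" where
  "refl_group a b \<Gamma> = group_gen (refl a b ` \<Gamma>)"

definition Phi :: "nat \<Rightarrow> nat \<Rightarrow> (real \<times> real) set \<Rightarrow> (real \<times> real) set" where
  "Phi a b \<Gamma> = orbit (refl_group a b \<Gamma>) \<Gamma>"

definition Phi_subsystem :: "nat \<Rightarrow> nat \<Rightarrow> (real \<times> real) set \<Rightarrow> bool" where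
  "Phi_subsystem a b \<Psi> \<longleftrightarrow> (\<exists>\<Gamma> \<subseteq> real_roots a b. \<Psi> = Phi a b \<Gamma>)"

text \<open>\<open>\<Delta>\<^sup>r\<^sup>e(\<Gamma>)\<close>; the additive subgroup \<^term>\<open>group_closure \<Gamma>\<close> is \<open>\<int>\<Gamma>\<close>.\<close>

definition Delta_re :: "nat \<Rightarrow> nat \<Rightarrow> (real \<times> real) set \<Rightarrow> (real \<times> real) set" where
  "Delta_re a b \<Gamma> = group_closure \<Gamma> \<inter> real_roots a b"

text \<open>The elements of a basis of \<open>\<Psi>\<close> need not be positive in \<open>\<Delta>\<close>.\<close>

definition has_basis ::
    "nat \<Rightarrow> nat \<Rightarrow> (real \<times> real) set \<Rightarrow> real \<times> real \<Rightarrow> real \<times> real \<Rightarrow> bool" where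
  "has_basis a b \<Psi> \<beta>1 \<beta>2 \<longleftrightarrow>
     \<beta>1 \<in> \<Psi> \<and> \<beta>2 \<in> \<Psi> \<and>
     \<Psi> = orbit (refl_group a b {\<beta>1, \<beta>2}) {\<beta>1, \<beta>2} \<and>
     (\<forall>v\<in>\<Psi>. \<exists>m n :: nat.
        v = real m *\<^sub>R \<beta>1 + real n *\<^sub>R \<beta>2 \<or> v = - (real m *\<^sub>R \<beta>1 + real n *\<^sub>R \<beta>2))"

text \<open>
  \<open>\<Psi>\<close> is a subsystem of type \<open>II\<^sub>S\<close>, respectively \<open>II\<^sub>L\<^sub>S\<close>, witnessed by the
  parameters \<open>d\<close> and \<open>r\<close>.
\<close>

definition type_II_S :: "nat \<Rightarrow> nat \<Rightarrow> int \<Rightarrow> int \<Rightarrow> (real \<times> real) set \<Rightarrow> bool" where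
  "type_II_S a b d r \<Psi> \<longleftrightarrow>
     Phi_subsystem a b \<Psi> \<and> d > 0 \<and> 0 \<le> r \<and> r < d \<and>
     has_basis a b \<Psi> (root_SU a b r) (root_SL a b (d - r - 1))"

definition type_II_LS :: "nat \<Rightarrow> nat \<Rightarrow> int \<Rightarrow> int \<Rightarrow> (real \<times> real) set \<Rightarrow> bool" where
  "type_II_LS a b d r \<Psi> \<longleftrightarrow>
     Phi_subsystem a b \<Psi> \<and> d \<ge> 0 \<and> - d \<le> r \<and> r \<le> d \<and>
     has_basis a b \<Psi> (root_LL a b r) (root_SU a b (d - r))"

end

theory Submission
  imports Defs
begin

text \<open>
  Up to sign, the real roots form a single chain \<open>\<beta>\<^sub>k\<close> indexed by the integers, in which long
  and short roots alternate (for \<open>a > b\<close>) and \<open>\<beta>\<^bsub>k+1\<^esub> + \<beta>\<^bsub>k-1\<^esub>\<close> is \<open>b\<close> times \<open>\<beta>\<^sub>k\<close> for even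
  \<open>k\<close> and \<open>a\<close> times \<open>\<beta>\<^sub>k\<close> for odd \<open>k\<close>. The reflection in \<open>\<beta>\<^sub>k\<close> maps \<open>\<beta>\<^sub>m\<close> to
  \<open>-\<beta>\<^bsub>2k-m\<^esub>\<close> (\<open>refl_rt\<close>), so subsystems are sets of integers closed under point reflections at
  their own members, and these are exactly the arithmetic progressions \<open>k + d\<int>\<close>, with \<open>d = 0\<close>
  for a single pair of roots (\<open>refl_closed_progression\<close>). Both sets in question have this form:
  \<open>\<Phi>(\<Gamma>)\<close> belongs to some \<open>k + d\<int>\<close>, and \<open>\<Delta>\<^sup>r\<^sup>e(\<Gamma>)\<close>, being closed under its own
  reflections because these have integer coefficients, to \<open>k + d'\<int>\<close> for some divisor \<open>d'\<close>
  of \<open>d\<close>.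

  The determinant of \<open>\<beta>\<^sub>k\<close> and \<open>\<beta>\<^bsub>k+n\<^esub>\<close> depends only on \<open>n\<close> and the parity of \<open>k\<close>; call it
  \<open>D(n)\<close>. All of \<open>\<int>\<Gamma>\<close> has determinant with \<open>\<beta>\<^sub>k\<close> divisible by \<open>D(d)\<close>, hence \<open>D(d)\<close> divides
  \<open>D(d')\<close> (\<open>Delta_re_progression\<close>). With \<open>U\<close> the Chebyshev sequence for \<open>t = ab - 2 \<ge> 2\<close> one has
  \<open>D(2m) = e U(m)\<close> and \<open>D(2m+1) = U(m) + U(m+1)\<close>, where \<open>e\<close> is \<open>a\<close> for even and \<open>b\<close> for odd
  \<open>k\<close>. Since \<open>U\<close> grows, a proper divisor \<open>d'\<close> is possible only if \<open>e = 1\<close>, that is, for a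
  progression of short roots with \<open>b = 1\<close>, and then only for \<open>d = 2d'\<close> with \<open>d'\<close> odd, where
  moreover \<open>d' = 1\<close> if \<open>a > 4\<close> (\<open>root_det_dvd_imp\<close>, \<open>proper_Delta_re\<close>).

  In these two situations the lattice does grow. For \<open>b = 1\<close> the two short neighbours of a long root
  add up to it, so the short roots generate everything. For \<open>a = 4\<close>, \<open>b = 1\<close> any two short roots
  symmetric about a long root add up to it (\<open>rt_even_as_sum\<close>), so the gap \<open>2d'\<close> is halved. The
  types \<open>II\<^sub>S\<close> and \<open>II\<^sub>L\<^sub>S\<close> translate into progressions with gap \<open>2d\<close> starting at a short root
  (\<open>type_II_S_iff\<close>) and with odd gap (\<open>type_II_LS_progression\<close>).
\<close>

section \<open>Two-sided integer recurrences\<close>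

text \<open>
  Two-sided linear recurrences \<open>f (n + 1) + f (n - 1) = c n * f n\<close> with integer coefficients
  control everything below. Running such a recurrence in both directions from two neighbouring
  values never leaves a subgroup: with the trivial subgroup this gives uniqueness of solutions,
  with \<open>\<int>\<close> or a multiple of it integrality and divisibility.
\<close>

lemma recurrence_closed:
  fixes f :: "int \<Rightarrow> 'a::real_vector" and c :: "int \<Rightarrow> int"
  assumes rec: "\<And>n. f (n + 1) + f (n - 1) = real_of_int (c n) *\<^sub>R f n"
    and "f 0 \<in> H" and "f 1 \<in> H"
    and H: "\<And>z x y. x \<in> H \<Longrightarrow> y \<in> H \<Longrightarrow> real_of_int z *\<^sub>R x - y \<in> H"
  shows "f n \<in> H"
proof -
  have up: "f (n + 1) = real_of_int (c n) *\<^sub>R f n - f (n - 1)"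
    and down: "f (n - 1) = real_of_int (c n) *\<^sub>R f n - f (n + 1)" for n
    using rec [of n] by (simp_all add: algebra_simps)
  have "f n \<in> H \<and> f (n + 1) \<in> H"
  proof (induction n rule: int_induct [where k = 0])
    case base
    then show ?case using assms(2,3) by simp
  next
    case (step1 i)
    then show ?case using H up [of "i + 1"] by simp
  next
    case (step2 i)
    then show ?case using H down [of i] by simp
  qed
  then show ?thesis ..
qed

section \<open>Sets of integers closed under point reflections\<close>

abbreviation progression :: "int \<Rightarrow> int \<Rightarrow> int set" where
  "progression k d \<equiv> {j. d dvd j - k}"

lemma progression_cong:
  assumes "d dvd k - l" shows "progression k d = progression l d"
proof -
  have "d dvd j - k \<longleftrightarrow> d dvd j - l" for j
    using dvd_add_left_iff [OF assms, of "j - k"] by simp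
  then show ?thesis by simp
qed

lemma exists_balanced_residue:
  assumes "e \<ge> (0::int)"
  obtains s where "[s = x] (mod (2 * e + 1))" and "- e \<le> s" and "s \<le> e"
proof
  let ?s = "(x + e) mod (2 * e + 1) - e"
  show "[?s = x] (mod (2 * e + 1))"
    by (simp add: cong_def mod_diff_left_eq)
  show "- e \<le> ?s" using assms by simp
  show "?s \<le> e" using pos_mod_bound [of "2 * e + 1" "x + e"] assms by linarith
qed

text \<open>
  The orbit of \<open>M\<close> under the group generated by the point reflections at the members of \<open>J\<close>.
  Centres and moved points are kept apart because the orbit of a single simple root under the
  Weyl group is also of this form.
\<close>

inductive_set refl_hull :: "int set \<Rightarrow> int set \<Rightarrow> int set" for J M where
  base: "m \<in> M \<Longrightarrow> m \<in> refl_hull J M"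
| refl: "j \<in> J \<Longrightarrow> m \<in> refl_hull J M \<Longrightarrow> 2 * j - m \<in> refl_hull J M"

text \<open>
  The conjugate of one point reflection by another is the point reflection at the image of its
  centre. So every point of the orbit of \<open>J\<close> is a centre that preserves this orbit.
\<close>

lemma refl_hull_self_closed:
  assumes "j \<in> refl_hull J J" and "m \<in> refl_hull J J"
  shows "2 * j - m \<in> refl_hull J J"
  using assms
proof (induction arbitrary: m)
  case (base j)
  then show ?case by (rule refl_hull.refl)
next
  case (refl i j)
  have "2 * (2 * i - j) - m = 2 * i - (2 * j - (2 * i - m))" by simp
  then show ?case
    using refl by (metis refl_hull.refl)
qed

lemma refl_hull_subset:
  assumes "M \<subseteq> X" and "\<And>j m. j \<in> J \<Longrightarrow> m \<in> X \<Longrightarrow> 2 * j - m \<in> X"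
  shows "refl_hull J M \<subseteq> X"
proof
  fix m assume "m \<in> refl_hull J M"
  then show "m \<in> X" by induction (use assms in auto)
qed

text \<open>
  If \<open>j\<close> and \<open>j + d\<close> are members at the least positive distance \<open>d\<close>, then repeated point
  reflection fills \<open>j + d\<int>\<close>, and any further member would lie closer than \<open>d\<close> to one of
  these. A singleton is covered by the difference \<open>d = 0\<close>.
\<close>

lemma refl_closed_progression:
  fixes X :: "int set"
  assumes closed: "\<And>j m. j \<in> X \<Longrightarrow> m \<in> X \<Longrightarrow> 2 * j - m \<in> X" and "k \<in> X"
  obtains d where "d \<ge> 0" and "X = progression k d"
proof (cases "X = {k}")
  case True
  then show ?thesis using that [of 0] by auto
next
  case False
  define P where "P p \<longleftrightarrow> p > 0 \<and> (\<exists>j\<in>X. j + int p \<in> X)" for p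
  obtain l where l: "l \<in> X" "l \<noteq> k" using False \<open>k \<in> X\<close> by blast
  have pos: "nat \<bar>l - k\<bar> > 0" using l by simp
  have "P (nat \<bar>l - k\<bar>)"
  proof (cases "l \<le> k")
    case True
    then have "l + int (nat \<bar>l - k\<bar>) = k" by simp
    then show ?thesis using l \<open>k \<in> X\<close> pos unfolding P_def by metis
  next
    case False
    then have "k + int (nat \<bar>l - k\<bar>) = l" by simp
    then show ?thesis using l \<open>k \<in> X\<close> pos unfolding P_def by metis
  qed
  then have Least: "P (LEAST p. P p)" by (rule LeastI)
  define d where "d = int (LEAST p. P p)"
  obtain j where d: "d > 0" "j \<in> X" "j + d \<in> X"
    using Least unfolding P_def d_def by auto
  have min: "d \<le> r" if "r > 0" "i \<in> X" "i + r \<in> X" for i r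
  proof -
    have "P (nat r)" using that unfolding P_def by auto
    then have "(LEAST p. P p) \<le> nat r" by (rule Least_le)
    then show ?thesis using \<open>r > 0\<close> unfolding d_def by simp
  qed
  have prog: "j + n * d \<in> X" for n
  proof -
    have "j + n * d \<in> X \<and> j + (n + 1) * d \<in> X"
    proof (induction n rule: int_induct [where k = 0])
      case (step1 i)
      then show ?case
        using closed [of "j + (i + 1) * d" "j + i * d"] by (simp add: algebra_simps)
    next
      case (step2 i)
      then show ?case
        using closed [of "j + i * d" "j + (i + 1) * d"] by (simp add: algebra_simps)
    qed (use d in simp)
    then show ?thesis ..
  qed
  have dvd_iff: "m \<in> X \<longleftrightarrow> d dvd m - j" for m
  proof
    assume "m \<in> X"
    have m: "j + ((m - j) div d) * d + (m - j) mod d = m" by (simp add: algebra_simps)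
    show "d dvd m - j"
    proof (rule ccontr)
      assume "\<not> d dvd m - j"
      then have "(m - j) mod d > 0"
        using d(1) by (metis dvd_eq_mod_eq_0 less_le pos_mod_sign)
      then have "d \<le> (m - j) mod d"
        using min [OF _ prog [of "(m - j) div d"]] m \<open>m \<in> X\<close> by metis
      then show False using pos_mod_bound [OF d(1), of "m - j"] by simp
    qed
  next
    assume "d dvd m - j"
    then obtain n where "m - j = d * n" ..
    then have "m = j + n * d" by (simp add: mult.commute)
    then show "m \<in> X" using prog by simp
  qed
  then have "d dvd k - j" using \<open>k \<in> X\<close> by simp
  then have "progression k d = progression j d" by (rule progression_cong)
  then show ?thesis using that [of d] d(1) dvd_iff by auto
qed

lemma refl_hull_pair:
  "refl_hull {k, k + d} {k, k + d} = progression k d"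
proof
  show "refl_hull {k, k + d} {k, k + d} \<subseteq> {j. d dvd j - k}"
  proof (rule refl_hull_subset)
    fix j m assume "j \<in> {k, k + d}" "m \<in> {j. d dvd j - k}"
    then have "d dvd j - k" "d dvd m - k" by auto
    then have "d dvd 2 * (j - k) - (m - k)" by (simp only: dvd_diff dvd_mult)
    then show "2 * j - m \<in> {j. d dvd j - k}" by (simp add: algebra_simps)
  qed auto
next
  have mem: "k \<in> refl_hull {k, k + d} {k, k + d}" "k + d \<in> refl_hull {k, k + d} {k, k + d}"
    by (auto intro: refl_hull.base)
  obtain c where "c \<ge> 0" and c: "refl_hull {k, k + d} {k, k + d} = {j. c dvd j - k}"
    using refl_closed_progression [OF refl_hull_self_closed mem(1)] by metis
  from mem(2) have "c dvd d" unfolding c by simp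
  then show "{j. d dvd j - k} \<subseteq> refl_hull {k, k + d} {k, k + d}"
    unfolding c by (auto intro: dvd_trans)
qed

lemma refl_hull_simple:
  shows "refl_hull {0, -1} {0} = {k. even k}" and "refl_hull {0, -1} {-1} = {k. odd k}"
proof -
  have shift: "k + 2 * n \<in> refl_hull {0, -1} {k}" for k n
  proof (induction n rule: int_induct [where k = 0])
    case base
    show ?case by (simp add: refl_hull.base)
  next
    case (step1 i)
    have "2 * 0 - (2 * (-1) - (k + 2 * i)) \<in> refl_hull {0, -1} {k}"
      by (intro refl_hull.refl step1) auto
    then show ?case by (simp add: algebra_simps)
  next
    case (step2 i)
    have "2 * (-1) - (2 * 0 - (k + 2 * i)) \<in> refl_hull {0, -1} {k}"
      by (intro refl_hull.refl step2) auto
    then show ?case by (simp add: algebra_simps)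
  qed
  show "refl_hull {0, -1} {0} = {k. even k}"
  proof (intro subset_antisym refl_hull_subset subsetI)
    fix k :: int assume "k \<in> {k. even k}"
    then obtain n where "k = 2 * n" by (auto elim: evenE)
    then show "k \<in> refl_hull {0, -1} {0}" using shift [of 0 n] by simp
  qed auto
  show "refl_hull {0, -1} {-1} = {k. odd k}"
  proof (intro subset_antisym refl_hull_subset subsetI)
    fix k :: int assume "k \<in> {k. odd k}"
    then obtain n where "k = 2 * n + 1" by (auto elim: oddE)
    then show "k \<in> refl_hull {0, -1} {-1}" using shift [of "-1" "n + 1"] by (simp add: algebra_simps)
  qed auto
qed

section \<open>Chebyshev numbers and determinants of pairs of roots\<close>

text \<open>
  \<open>cheb_nat t n\<close> is the Chebyshev polynomial of the second kind \<open>U\<^bsub>n-1\<^esub>(t/2)\<close>.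
\<close>

fun cheb_nat :: "int \<Rightarrow> nat \<Rightarrow> int" where
  "cheb_nat t 0 = 0"
| "cheb_nat t (Suc 0) = 1"
| "cheb_nat t (Suc (Suc n)) = t * cheb_nat t (Suc n) - cheb_nat t n"

text \<open>
  The odd extension to all integers, for which the recurrence holds in both directions.
\<close>

definition cheb :: "int \<Rightarrow> int \<Rightarrow> int" where
  "cheb t n = sgn n * cheb_nat t (nat \<bar>n\<bar>)"

lemma cheb_0 [simp]: "cheb t 0 = 0" and cheb_1 [simp]: "cheb t 1 = 1"
  by (simp_all add: cheb_def)

lemma cheb_rec: "cheb t (n + 1) + cheb t (n - 1) = t * cheb t n"
proof -
  consider m where "n = int (Suc m)" | "n = 0" | m where "n = - int (Suc m)"
    by (metis int_cases3 gr0_conv_Suc)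
  then show ?thesis
  proof cases
    case (1 m)
    then have "nat \<bar>n + 1\<bar> = Suc (Suc m)" "nat \<bar>n\<bar> = Suc m" "nat \<bar>n - 1\<bar> = m" by auto
    moreover have "n > 0" "n + 1 > 0" "n - 1 \<ge> 0" "n - 1 = 0 \<longleftrightarrow> m = 0" using 1 by auto
    ultimately show ?thesis by (cases "m = 0") (simp_all add: cheb_def numeral_2_eq_2)
  next
    case (3 m)
    then have "nat \<bar>n - 1\<bar> = Suc (Suc m)" "nat \<bar>n\<bar> = Suc m" "nat \<bar>n + 1\<bar> = m" by auto
    moreover have "n < 0" "n - 1 < 0" "n + 1 \<le> 0" "n + 1 = 0 \<longleftrightarrow> m = 0" using 3 by auto
    ultimately show ?thesis by (cases "m = 0") (simp_all add: cheb_def)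
  qed (auto simp: cheb_def)
qed

lemma cheb_uminus: "cheb t (- n) = - cheb t n"
  by (simp add: cheb_def sgn_minus)

text \<open>
  For \<open>t \<ge> 2\<close> the recurrence gives \<open>cheb t (n + 2) - cheb t (n + 1) \<ge> cheb t (n + 1) - cheb t n\<close>,
  so the increments never drop below the initial one.
\<close>

lemma cheb_step:
  assumes "t \<ge> 2" and "n \<ge> 0"
  shows "cheb t n < cheb t (n + 1)" and "cheb t n \<ge> 0"
proof -
  have "cheb t n < cheb t (n + 1) \<and> cheb t n \<ge> 0"
    using \<open>n \<ge> 0\<close>
  proof (induction n rule: int_ge_induct)
    case base
    then show ?case by simp
  next
    case (step n)
    have next_eq: "n + 1 + 1 = n + 2" by simp
    have "cheb t (n + 2) = t * cheb t (n + 1) - cheb t n"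
      using cheb_rec [of t "n + 1"] by (simp add: algebra_simps)
    moreover have "t * cheb t (n + 1) \<ge> 2 * cheb t (n + 1)"
      using assms step by (intro mult_right_mono) auto
    ultimately show ?case using step unfolding next_eq by linarith
  qed
  then show "cheb t n < cheb t (n + 1)" and "cheb t n \<ge> 0" by auto
qed

lemma cheb_strict_mono:
  assumes "t \<ge> 2" and "0 \<le> m" and "m < n"
  shows "cheb t m < cheb t n"
proof -
  have "m + 1 \<le> n" using assms by simp
  then show ?thesis
  proof (induction n rule: int_ge_induct)
    case base
    then show ?case using cheb_step assms by auto
  next
    case (step n)
    then show ?case using cheb_step(1) [OF \<open>t \<ge> 2\<close>, of n] assms by auto
  qed
qed

lemma cheb_two: "cheb 2 n = n"
proof -
  have "real_of_int (cheb 2 n - n) \<in> {0}"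
  proof (rule recurrence_closed [where c = "\<lambda>_. 2" and f = "\<lambda>n. real_of_int (cheb 2 n - n)"])
    fix n
    have "real_of_int (cheb 2 (n + 1) + cheb 2 (n - 1)) = real_of_int (2 * cheb 2 n)"
      by (simp only: cheb_rec)
    then show "real_of_int (cheb 2 (n + 1) - (n + 1)) + real_of_int (cheb 2 (n - 1) - (n - 1)) =
        real_of_int 2 *\<^sub>R real_of_int (cheb 2 n - n)"
      by simp
  qed auto
  then show ?thesis by simp
qed

text \<open>
  The recurrence with the two Cartan coefficients \<open>e\<close>, \<open>e'\<close> alternating, started at \<open>0, 1\<close>,
  where \<open>t = e * e' - 2\<close>. It will turn out to be the determinant of two real roots at index
  distance \<open>n\<close>. The subsequences of even and of odd indices are each governed by the
  recurrence with the constant coefficient \<open>t\<close>, which gives the closed form used here.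
\<close>

definition root_det :: "int \<Rightarrow> int \<Rightarrow> int \<Rightarrow> int" where
  "root_det t e n =
     (if even n then e * cheb t (n div 2) else cheb t (n div 2) + cheb t (n div 2 + 1))"

lemma root_det_even: "root_det t e (2 * m) = e * cheb t m"
  and root_det_odd: "root_det t e (2 * m + 1) = cheb t m + cheb t (m + 1)"
  by (simp_all add: root_det_def)

lemma root_det_0 [simp]: "root_det t e 0 = 0" and root_det_1 [simp]: "root_det t e 1 = 1"
  by (simp_all add: root_det_def)

lemma root_det_rec:
  assumes "e * e' = t + 2"
  shows "root_det t e (n + 1) + root_det t e (n - 1) =
    (if even n then e' else e) * root_det t e n"
proof (cases "even n")
  case True
  then obtain m where n: "n = 2 * m" by blast
  have "root_det t e (n - 1) = cheb t (m - 1) + cheb t m"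
    using root_det_odd [of t e "m - 1"] by (simp add: n)
  moreover have "root_det t e (n + 1) = cheb t m + cheb t (m + 1)"
    by (simp add: n root_det_odd)
  moreover have "e' * root_det t e n = (t + 2) * cheb t m"
    by (simp add: n root_det_even assms [symmetric])
  ultimately show ?thesis using True cheb_rec [of t m] by (simp add: algebra_simps)
next
  case False
  then obtain m where n: "n = 2 * m + 1" by (auto elim: oddE)
  have "root_det t e (n + 1) = e * cheb t (m + 1)" "root_det t e (n - 1) = e * cheb t m"
    using root_det_even [of t e "m + 1"] root_det_even [of t e m] by (simp_all add: n add.commute)
  then show ?thesis using False root_det_odd [of t e m] by (simp add: n algebra_simps)
qed

lemma root_det_pos:
  assumes "t \<ge> 2" and "e > 0" and "n > 0"
  shows "root_det t e n > 0"
proof (cases "even n")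
  case True
  then obtain m where n: "n = 2 * m" by blast
  then show ?thesis using assms cheb_strict_mono [of t 0 m] by (simp add: root_det_even)
next
  case False
  then obtain m where n: "n = 2 * m + 1" by (auto elim: oddE)
  then show ?thesis
    using assms cheb_step [of t m] by (simp add: root_det_odd)
qed

text \<open>
  For \<open>t \<ge> 3\<close> the sequence more than doubles in every step, so the sum of two neighbours stays
  below the next value, and below \<open>cheb t n\<close> as soon as \<open>m \<ge> 1\<close>.
\<close>

lemma cheb_le_sum_neighbours:
  assumes t: "t \<ge> 3" and m: "m \<ge> 0" and n: "n \<ge> 2 * m + 1"
    and le: "cheb t n \<le> cheb t m + cheb t (m + 1)"
  shows "m = 0 \<and> n = 1"
proof -
  have lt: "cheb t m < cheb t (m + 1)" "cheb t m \<ge> 0" using cheb_step [of t m] t m by auto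
  show ?thesis
  proof (cases "m = 0")
    case True
    then have "cheb t n \<le> cheb t 1" using le by simp
    then show ?thesis using cheb_strict_mono [of t 1 n] t True n by fastforce
  next
    case False
    have "cheb t (m + 2) = t * cheb t (m + 1) - cheb t m"
      using cheb_rec [of t "m + 1"] by (simp add: algebra_simps)
    moreover have "3 * cheb t (m + 1) \<le> t * cheb t (m + 1)"
      using t lt by (intro mult_right_mono) auto
    ultimately have "cheb t m + cheb t (m + 1) < cheb t (m + 2)" using lt by linarith
    moreover have "cheb t (m + 2) \<le> cheb t n"
      using cheb_strict_mono [of t "m + 2" n] t m n False by (cases "m + 2 = n") auto
    ultimately show ?thesis using le by linarith
  qed
qed

text \<open>
  The arithmetic core. Within one parity class \<open>root_det\<close> is strictly increasing, so a proper
  divisor \<open>d'\<close> of \<open>d\<close> with a value at least as large must be odd while \<open>d\<close> is even. Then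
  \<open>d'\<close> divides \<open>d / 2\<close>, and the factor \<open>e\<close> in the even case has to be \<open>1\<close>, as otherwise it
  outweighs the sum of two smaller Chebyshev numbers. What remains is growth: at \<open>t = 2\<close> the
  Chebyshev numbers are linear and exactly \<open>d = 2 * d'\<close> survives, for larger \<open>t\<close> only \<open>d = 2\<close>.
\<close>

lemma root_det_dvd_imp:
  assumes t: "t \<ge> 2" and e: "e > 0" and d': "d' \<ge> 0" "d' dvd d" "d \<ge> 0" "d' \<noteq> d"
    and dvd: "root_det t e d dvd root_det t e d'"
  shows "e = 1 \<and> odd d' \<and> d = 2 * d' \<and> (t \<ge> 3 \<longrightarrow> d' = 1)"
proof -
  have "d' \<noteq> 0" using d'(2,4) by auto
  then have pos: "d' > 0" using d' by simp
  have "d > 0" 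
  proof (rule ccontr)
    assume "\<not> d > 0"
    then have "root_det t e d' = 0" using dvd d' by simp
    then show False using root_det_pos [OF t e pos] by simp
  qed
  have lt: "d' < d" using d' \<open>d > 0\<close> by (simp add: order.strict_iff_order zdvd_imp_le)
  have le: "root_det t e d \<le> root_det t e d'"
    using dvd root_det_pos [OF t e pos] by (rule zdvd_imp_le)
  have "odd d'"
  proof
    assume "even d'"
    then have "even d" using d'(2) by (rule dvd_trans)
    with \<open>even d'\<close> obtain m n where mn: "d' = 2 * m" "d = 2 * n" by blast
    then have "cheb t m < cheb t n" using cheb_strict_mono [of t m n] t lt pos by simp
    then show False using le e by (simp add: mn root_det_even)
  qed
  then obtain m where m: "d' = 2 * m + 1" by (auto elim: oddE)
  have "m \<ge> 0" using m pos by simp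
  have "even d"
  proof (rule ccontr)
    assume "odd d"
    then obtain n where n: "d = 2 * n + 1" by (auto elim: oddE)
    then have "cheb t m < cheb t n" "cheb t (m + 1) < cheb t (n + 1)"
      using cheb_strict_mono [of t m n] cheb_strict_mono [of t "m + 1" "n + 1"] t lt m \<open>m \<ge> 0\<close>
      by simp_all
    then show False using le by (simp add: m n root_det_odd)
  qed
  then obtain n where n: "d = 2 * n" by blast
  have "d' dvd n"
    using \<open>odd d'\<close> d'(2) n by (metis coprime_dvd_mult_right_iff coprime_right_2_iff_odd)
  have "n > 0" using n \<open>d > 0\<close> by simp
  then have "d' \<le> n" using \<open>d' dvd n\<close> zdvd_imp_le by blast
  have cheb_le: "e * cheb t n \<le> cheb t m + cheb t (m + 1)"
    using le by (simp add: m n root_det_odd root_det_even)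
  have "cheb t m < cheb t (m + 1)" "cheb t m \<ge> 0" using cheb_step [of t m] t \<open>m \<ge> 0\<close> by auto
  have "cheb t (m + 1) \<le> cheb t n"
    using cheb_strict_mono [of t "m + 1" n] t m \<open>m \<ge> 0\<close> \<open>d' \<le> n\<close> by (cases "m + 1 = n") auto
  have "e = 1"
  proof (rule ccontr)
    assume "e \<noteq> 1"
    then have "2 * cheb t n \<le> e * cheb t n"
      using e \<open>cheb t m \<ge> 0\<close> \<open>cheb t m < _\<close> \<open>cheb t (m + 1) \<le> _\<close> by (intro mult_right_mono) auto
    then show False using \<open>cheb t m < _\<close> \<open>cheb t (m + 1) \<le> _\<close> cheb_le by linarith
  qed
  show ?thesis
  proof (cases "t \<ge> 3")
    case True
    then have "m = 0 \<and> n = 1"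
      using cheb_le_sum_neighbours [of t m n] \<open>m \<ge> 0\<close> m \<open>d' \<le> n\<close> cheb_le \<open>e = 1\<close> by simp
    then show ?thesis using \<open>e = 1\<close> m n by simp
  next
    case False
    then have "t = 2" using t by simp
    then have "n \<le> d'" using cheb_le \<open>e = 1\<close> m by (simp add: cheb_two)
    then show ?thesis using \<open>d' \<le> n\<close> \<open>e = 1\<close> \<open>odd d'\<close> n False by simp
  qed
qed

section \<open>Reflections of the root space and the group they generate\<close>

definition det2 :: "real \<times> real \<Rightarrow> real \<times> real \<Rightarrow> real" where
  "det2 u v = fst u * snd v - snd u * fst v"

lemma det2_simps:
  "det2 u (v + w) = det2 u v + det2 u w" "det2 u (v - w) = det2 u v - det2 u w"
  "det2 u (- v) = - det2 u v" "det2 u (c *\<^sub>R v) = c * det2 u v" "det2 u u = 0" "det2 u 0 = 0"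
  by (simp_all add: det2_def algebra_simps)

lemma det2_swap: "det2 v u = - det2 u v"
  by (simp add: det2_def)

text \<open>
  Cramer's rule for the coordinates of \<open>v\<close> with respect to \<open>u\<close> and \<open>w\<close>.
\<close>

lemma det2_cramer: "det2 u w *\<^sub>R v = det2 v w *\<^sub>R u + det2 u v *\<^sub>R w"
  by (simp add: det2_def prod_eq_iff algebra_simps)

lemma bform_simps:
  "bform a b (u - v) w = bform a b u w - bform a b v w"
  "bform a b (u + v) w = bform a b u w + bform a b v w"
  "bform a b u (v - w) = bform a b u v - bform a b u w"
  "bform a b (c *\<^sub>R u) v = c * bform a b u v"
  "bform a b u (c *\<^sub>R v) = c * bform a b u v"
  "bform a b (- u) v = - bform a b u v"
  "bform a b u (- v) = - bform a b u v"
  unfolding bform_def by (simp_all add: algebra_simps)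

lemma bform_commute: "bform a b u v = bform a b v u"
  unfolding bform_def by (simp add: algebra_simps)

lemma refl_uminus: "refl a b (- u) v = refl a b u v" "refl a b u (- v) = - refl a b u v"
  by (simp_all add: refl_def bform_simps)

lemma refl_linear:
  "refl a b u (v + w) = refl a b u v + refl a b u w"
  "refl a b u (c *\<^sub>R v) = c *\<^sub>R refl a b u v"
  by (simp_all add: refl_def bform_simps algebra_simps add_divide_distrib)

lemma refl_involution:
  assumes "bform a b u u \<noteq> 0"
  shows "refl a b u (refl a b u v) = v"
  using assms by (simp add: refl_def bform_simps algebra_simps)

lemma group_closure_scaleR_int:
  fixes v :: "'a::real_vector"
  assumes "v \<in> group_closure S"
  shows "real_of_int z *\<^sub>R v \<in> group_closure S"
proof (induction z rule: int_induct [where k = 0])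
  case (step1 i)
  then show ?case using assms by (simp add: scaleR_add_left group_closure_add)
next
  case (step2 i)
  then show ?case using assms by (simp add: scaleR_diff_left group_closure.diff)
qed simp

lemma orbitI: "g \<in> G \<Longrightarrow> v \<in> S \<Longrightarrow> g v \<in> orbit G S"
  unfolding orbit_def by blast

lemma root_space_Bij_carrier: "f \<in> carrier root_space_Bij \<longleftrightarrow> bij f"
  by (simp add: BijGroup_def Bij_def)

lemma root_space_Bij_mult: "bij f \<Longrightarrow> bij g \<Longrightarrow> f \<otimes>\<^bsub>root_space_Bij\<^esub> g = f \<circ> g"
  by (simp add: BijGroup_def Bij_def compose_def fun_eq_iff)

lemma root_space_Bij_one: "\<one>\<^bsub>root_space_Bij\<^esub> = id"
  by (simp add: BijGroup_def id_def restrict_def)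

interpretation root_space: group root_space_Bij
  by (rule group_BijGroup)

lemma involution_bij:
  assumes "\<And>v. f (f v) = v"
  shows "bij f"
  using assms by (metis bijI')

lemma root_space_Bij_inv_involution:
  assumes "\<And>v. f (f v) = v"
  shows "inv\<^bsub>root_space_Bij\<^esub> f = f"
proof (rule root_space.inv_equality)
  have "bij f" using assms by (rule involution_bij)
  then show "f \<otimes>\<^bsub>root_space_Bij\<^esub> f = \<one>\<^bsub>root_space_Bij\<^esub>"
    using assms by (simp add: root_space_Bij_mult root_space_Bij_one fun_eq_iff)
  show "f \<in> carrier root_space_Bij" "f \<in> carrier root_space_Bij"
    using \<open>bij f\<close> by (simp_all add: root_space_Bij_carrier)
qed

text \<open>
  A bijection that shifts a family indexed by the integers has all its integer powers acting on the
  family by shifts. This turns the powers of \<open>w\<^sub>1 w\<^sub>2\<close> and \<open>w\<^sub>2 w\<^sub>1\<close> into index arithmetic.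
\<close>

lemma int_pow_shift:
  fixes j :: int
  assumes "bij f" and shift: "\<And>m. f (h m) = h (m + 1)"
  shows "(f [^]\<^bsub>root_space_Bij\<^esub> j) (h m) = h (m + j)"
proof -
  have f: "f \<in> carrier root_space_Bij" using assms by (simp add: root_space_Bij_carrier)
  have "bij (f [^]\<^bsub>root_space_Bij\<^esub> i)" for i :: int
    using root_space.int_pow_closed [OF f] by (simp only: root_space_Bij_carrier)
  then have step: "(f [^]\<^bsub>root_space_Bij\<^esub> (i + 1)) v = (f [^]\<^bsub>root_space_Bij\<^esub> i) (f v)"
    for i :: int and v
    using root_space.int_pow_mult [OF f, of i 1] \<open>bij f\<close> root_space.int_pow_1 [OF f]
    by (simp add: root_space_Bij_mult)
  show ?thesis
  proof (induction j arbitrary: m rule: int_induct [where k = 0])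
    case base
    show ?case by (simp add: root_space_Bij_one)
  next
    case (step1 i)
    then show ?case by (simp add: step shift add.assoc add.commute [of 1])
  next
    case (step2 i)
    have "(f [^]\<^bsub>root_space_Bij\<^esub> (i - 1)) (h m) = (f [^]\<^bsub>root_space_Bij\<^esub> i) (h (m - 1))"
      using step [of "i - 1" "h (m - 1)"] shift [of "m - 1"] by simp
    then show ?case using step2 by (simp add: algebra_simps)
  qed
qed

lemma w1_eq: "w1 b v = (- fst v + real b * snd v, snd v)"
  and w2_eq: "w2 a v = (fst v, real a * fst v - snd v)"
  by (simp_all add: w1_def w2_def alpha1_def alpha2_def algebra_simps)

lemma w1_refl: "a > 0 \<Longrightarrow> b > 0 \<Longrightarrow> w1 b = refl a b alpha1"
  and w2_refl: "w2 a = refl a b alpha2"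
  by (auto simp: fun_eq_iff w1_eq w2_eq refl_def bform_def alpha1_def alpha2_def field_simps)

section \<open>The real roots as one sequence indexed by the integers\<close>

locale rank2 =
  fixes a b :: nat
  assumes a_pos: "a > 0" and b_pos: "b > 0" and ab_ge_4: "a * b \<ge> 4"
begin

text \<open>
  The trace of \<open>w\<^sub>1 w\<^sub>2\<close>, which governs the recurrence within each parity class of the chain of
  roots below.
\<close>

definition \<tau> :: int where "\<tau> = int a * int b - 2"

lemma tau_ge: "\<tau> \<ge> 2"
proof -
  have "int (a * b) \<ge> 4" using ab_ge_4 by linarith
  then show ?thesis by (simp add: \<tau>_def)
qed

text \<open>
  The coefficients of the recurrence of the roots, alternately the two off-diagonal entries of the
  Cartan matrix up to sign.
\<close>

definition cartan :: "int \<Rightarrow> int" where "cartan k = (if even k then int b else int a)"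

text \<open>
  Up to the factor \<open>2 / b\<close>, the squared length of the root of index \<open>k\<close>; also the determinant of
  the roots of indices \<open>k\<close> and \<open>k + 2\<close>.
\<close>

definition weight :: "int \<Rightarrow> int" where "weight k = (if even k then int a else int b)"

text \<open>
  The chain \<open>\<dots>, -\<alpha>\<^sub>2, \<alpha>\<^sub>1, w\<^sub>1\<alpha>\<^sub>2, w\<^sub>1w\<^sub>2\<alpha>\<^sub>1, \<dots>\<close>, with \<open>\<alpha>\<^sub>1\<close> at index \<open>0\<close> and
  \<open>-\<alpha>\<^sub>2\<close> at index \<open>-1\<close>. Even indices give \<open>W\<alpha>\<^sub>1\<close> and odd indices \<open>W\<alpha>\<^sub>2\<close>, up to sign. The
  two coordinates of a root are its determinants with these two members of the chain, which
  explains the formula.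
\<close>

definition rt :: "int \<Rightarrow> real \<times> real" where
  "rt k = (real_of_int (root_det \<tau> (int b) (k + 1)), real_of_int (root_det \<tau> (int a) k))"

lemma weight_pos: "weight k > 0"
  using a_pos b_pos by (simp add: weight_def)

lemma rt_rec: "rt (k + 1) + rt (k - 1) = real_of_int (cartan k) *\<^sub>R rt k"
proof -
  have "root_det \<tau> (int a) (k + 1) + root_det \<tau> (int a) (k - 1) = cartan k * root_det \<tau> (int a) k"
    by (subst root_det_rec [where e' = "int b"]) (simp_all add: \<tau>_def cartan_def)
  moreover have "root_det \<tau> (int b) (k + 1 + 1) + root_det \<tau> (int b) (k + 1 - 1) =
      cartan k * root_det \<tau> (int b) (k + 1)"
    by (subst root_det_rec [where e' = "int a"]) (simp_all add: \<tau>_def cartan_def)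
  ultimately show ?thesis
    by (simp add: rt_def prod_eq_iff flip: of_int_add of_int_mult)
qed

lemma rt_Suc: "rt (k + 2) = real_of_int (cartan (k + 1)) *\<^sub>R rt (k + 1) - rt k"
  using rt_rec [of "k + 1"] by (simp add: algebra_simps)

lemma rt_0: "rt 0 = alpha1" and rt_m1: "rt (-1) = - alpha2"
  using root_det_odd [of \<tau> "int a" "-1"] cheb_uminus [of \<tau> 1]
  by (simp_all add: rt_def alpha1_def alpha2_def)

lemma cartan_weight: "real_of_int (cartan k) * real_of_int (weight k) = real a * real b"
  by (simp add: cartan_def weight_def)

text \<open>
  Lengths and products of neighbours are propagated together along the recurrence, in both
  directions.
\<close>

lemma bform_rt_aux:
  "bform a b (rt k) (rt k) = 2 * weight k / b \<and>
   bform a b (rt (k + 1)) (rt (k + 1)) = 2 * weight (k + 1) / b \<and>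
   bform a b (rt k) (rt (k + 1)) = a"
proof (induction k rule: int_induct [where k = 0])
  case base
  have "rt 1 = (real b, 1)"
    using root_det_even [of \<tau> "int b" 1] by (simp add: rt_def)
  then show ?case using b_pos by (simp add: rt_0 alpha1_def bform_def weight_def field_simps)
next
  case (step1 i)
  have eq: "i + 1 + 1 = i + 2" by simp
  have w: "weight (i + 2) = weight i" by (simp add: weight_def)
  have cw: "cartan (i + 1) * (2 * weight (i + 1) / b) = 2 * a"
    using cartan_weight [of "i + 1"] b_pos by (simp add: field_simps)
  have "bform a b (rt (i + 1)) (rt (i + 2)) = a"
    using step1 cw bform_commute [of a b "rt (i + 1)" "rt i"] by (simp add: rt_Suc bform_simps)
  moreover have "bform a b (rt (i + 2)) (rt (i + 2)) = 2 * weight i / b"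
    using step1 cw bform_commute [of a b "rt (i + 1)" "rt i"]
    by (simp add: rt_Suc bform_simps)
  ultimately show ?case using step1 by (simp add: eq w)
next
  case (step2 i)
  have "rt (i - 1) = real_of_int (cartan i) *\<^sub>R rt i - rt (i + 1)"
    using rt_rec [of i] by (simp add: algebra_simps)
  moreover have w: "weight (i - 1) = weight (i + 1)" by (simp add: weight_def)
  moreover have cw: "cartan i * (2 * weight i / b) = 2 * a"
    using cartan_weight [of i] b_pos by (simp add: field_simps)
  ultimately show ?case
    using step2 bform_commute [of a b "rt (i + 1)" "rt i"] by (simp add: bform_simps)
qed

lemma bform_rt: "bform a b (rt k) (rt k) = 2 * weight k / b"
  and bform_rt_next: "bform a b (rt k) (rt (k + 1)) = a"
  using bform_rt_aux by auto

lemma bform_rt_nonzero: "bform a b (rt k) (rt k) \<noteq> 0"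
  using weight_pos [of k] b_pos by (simp add: bform_rt)

lemma cartan_bform_rt:
  "2 * bform a b (rt (k + 1)) (rt k) / bform a b (rt k) (rt k) = cartan k"
  using cartan_weight [of k] b_pos weight_pos [of k]
  unfolding bform_commute [of a b "rt (k + 1)"] bform_rt_next bform_rt
  by (simp add: field_simps)

lemma cartan_reflect: "cartan (k - n) = cartan (k + n)"
  by (simp add: cartan_def)

text \<open>
  Up to sign, reflection in a root is a point reflection of the indices: both sides satisfy the same
  recurrence in \<open>m\<close>, because the Cartan coefficients are symmetric about every index, and they agree
  at \<open>m = k\<close> and \<open>m = k + 1\<close>.
\<close>

lemma refl_rt: "refl a b (rt k) (rt m) = - rt (2 * k - m)"
proof -
  have "refl a b (rt k) (rt (k + (m - k))) + rt (k - (m - k)) \<in> {0}"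
  proof (rule recurrence_closed [where c = "\<lambda>n. cartan (k + n)"
        and f = "\<lambda>n. refl a b (rt k) (rt (k + n)) + rt (k - n)"])
    fix n
    have l: "rt (k - (n + 1)) + rt (k - (n - 1)) = real_of_int (cartan (k + n)) *\<^sub>R rt (k - n)"
      using rt_rec [of "k - n"] by (simp add: cartan_reflect algebra_simps)
    have "rt (k + (n + 1)) + rt (k + (n - 1)) = real_of_int (cartan (k + n)) *\<^sub>R rt (k + n)"
      using rt_rec [of "k + n"] by (simp add: algebra_simps)
    then have u: "refl a b (rt k) (rt (k + (n + 1))) + refl a b (rt k) (rt (k + (n - 1))) =
        real_of_int (cartan (k + n)) *\<^sub>R refl a b (rt k) (rt (k + n))"
      by (metis refl_linear)
    show "refl a b (rt k) (rt (k + (n + 1))) + rt (k - (n + 1)) +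
        (refl a b (rt k) (rt (k + (n - 1))) + rt (k - (n - 1))) =
        real_of_int (cartan (k + n)) *\<^sub>R (refl a b (rt k) (rt (k + n)) + rt (k - n))"
      unfolding scaleR_add_right l [symmetric] u [symmetric] by simp
  next
    show "refl a b (rt k) (rt (k + 0)) + rt (k - 0) \<in> {0}"
      using bform_rt_nonzero [of k] by (simp add: refl_def scaleR_2)
    show "refl a b (rt k) (rt (k + 1)) + rt (k - 1) \<in> {0}"
      using rt_rec [of k] unfolding refl_def cartan_bform_rt by (simp add: algebra_simps)
  qed simp
  then show ?thesis by (simp add: eq_neg_iff_add_eq_0 algebra_simps)
qed

text \<open>
  The coefficient \<open>2(\<beta>,\<alpha>)/(\<alpha>,\<alpha>)\<close> is an integer for real roots, again by running the
  recurrence.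
\<close>

lemma rt_integral_sum: obtains z :: int where "rt (m + d) + rt (m - d) = real_of_int z *\<^sub>R rt m"
proof -
  define N where "N n = 2 * bform a b (rt (m + n)) (rt m) / bform a b (rt m) (rt m)" for n
  have "N d \<in> \<int>"
  proof (rule recurrence_closed [where c = "\<lambda>n. cartan (m + n)" and f = N])
    fix n
    have "rt (m + (n + 1)) + rt (m + (n - 1)) = real_of_int (cartan (m + n)) *\<^sub>R rt (m + n)"
      using rt_rec [of "m + n"] by (simp add: algebra_simps)
    then have "bform a b (rt (m + (n + 1))) (rt m) + bform a b (rt (m + (n - 1))) (rt m) =
        real_of_int (cartan (m + n)) * bform a b (rt (m + n)) (rt m)"
      by (metis bform_simps(2,4))
    from arg_cong [OF this, of "\<lambda>x. 2 * x / bform a b (rt m) (rt m)"]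
    show "N (n + 1) + N (n - 1) = real_of_int (cartan (m + n)) *\<^sub>R N n"
      by (simp add: N_def distrib_left add_divide_distrib)
  next
    show "N 0 \<in> \<int>" using bform_rt_nonzero [of m] by (simp add: N_def)
    show "N 1 \<in> \<int>" unfolding N_def cartan_bform_rt by simp
  qed simp
  then obtain z :: int where z: "N d = real_of_int z" by (auto elim: Ints_cases)
  have "rt (m + d) - N d *\<^sub>R rt m = - rt (m - d)"
    using refl_rt [of m "m + d"] unfolding refl_def N_def by (simp add: algebra_simps)
  then have "rt (m + d) + rt (m - d) = real_of_int z *\<^sub>R rt m"
    unfolding z by (simp add: algebra_simps)
  then show ?thesis by (rule that)
qed

lemma det_rt_next: "det2 (rt k) (rt (k + 1)) = 1"
proof (induction k rule: int_induct [where k = 0])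
  case base
  show ?case using rt_0 by (simp add: rt_def det2_def alpha1_def)
next
  case (step1 i)
  have "det2 (rt (i + 1)) (rt (i + 2)) = det2 (rt i) (rt (i + 1))"
    by (simp add: rt_Suc det2_simps det2_swap [of "rt (i + 1)" "rt i"])
  then show ?case using step1 by (simp add: add.assoc)
next
  case (step2 i)
  have "rt (i - 1) = real_of_int (cartan i) *\<^sub>R rt i - rt (i + 1)"
    using rt_rec [of i] by (simp add: algebra_simps)
  then show ?case using step2
    by (simp add: det2_swap [of "_ - _"] det2_simps)
qed

text \<open>
  For a fixed first root both sides solve the recurrence with the same two initial values.
\<close>

lemma det_rt: "det2 (rt k) (rt (k + n)) = root_det \<tau> (weight k) n"
proof -
  have "det2 (rt k) (rt (k + n)) - real_of_int (root_det \<tau> (weight k) n) \<in> {0}"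
  proof (rule recurrence_closed [where c = "\<lambda>n. cartan (k + n)"
        and f = "\<lambda>n. det2 (rt k) (rt (k + n)) - real_of_int (root_det \<tau> (weight k) n)"])
    fix n
    have "rt (k + (n + 1)) + rt (k + (n - 1)) = real_of_int (cartan (k + n)) *\<^sub>R rt (k + n)"
      using rt_rec [of "k + n"] by (simp add: algebra_simps)
    then have "det2 (rt k) (rt (k + (n + 1))) + det2 (rt k) (rt (k + (n - 1))) =
        cartan (k + n) * det2 (rt k) (rt (k + n))"
      by (metis det2_simps(1,4))
    moreover have "root_det \<tau> (weight k) (n + 1) + root_det \<tau> (weight k) (n - 1) =
        cartan (k + n) * root_det \<tau> (weight k) n"
      by (subst root_det_rec [where e' = "cartan k"]) (auto simp: \<tau>_def weight_def cartan_def)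
    then have "real_of_int (root_det \<tau> (weight k) (n + 1)) + real_of_int (root_det \<tau> (weight k) (n - 1)) =
        cartan (k + n) * real_of_int (root_det \<tau> (weight k) n)"
      by (simp flip: of_int_add of_int_mult)
    ultimately show "det2 (rt k) (rt (k + (n + 1))) - real_of_int (root_det \<tau> (weight k) (n + 1)) +
        (det2 (rt k) (rt (k + (n - 1))) - real_of_int (root_det \<tau> (weight k) (n - 1))) =
        real_of_int (cartan (k + n)) *\<^sub>R
          (det2 (rt k) (rt (k + n)) - real_of_int (root_det \<tau> (weight k) n))"
      by (simp add: right_diff_distrib)
  qed (simp_all add: det2_simps det_rt_next)
  then show ?thesis by simp
qed

lemma det_rt_pos: "i < j \<Longrightarrow> det2 (rt i) (rt j) > 0"
  using det_rt [of i "j - i"] root_det_pos [OF tau_ge weight_pos, of "j - i" i] by simp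

lemma rt_eq_iff: "rt i = rt j \<longleftrightarrow> i = j" and rt_neq_minus: "rt i \<noteq> - rt j"
proof -
  have nonzero: "det2 (rt i) (rt j) \<noteq> 0" if "i \<noteq> j"
    using det_rt_pos [of i j] det_rt_pos [of j i] det2_swap [of "rt i" "rt j"] that
    by (cases i j rule: linorder_cases) auto
  show "rt i = rt j \<longleftrightarrow> i = j" using nonzero by (metis det2_simps(5))
  show "rt i \<noteq> - rt j"
  proof
    assume eq: "rt i = - rt j"
    then have "det2 (rt i) (rt j) = 0" by (simp add: det2_def)
    then have "i = j" using nonzero by blast
    then have "rt j = 0" using eq by (simp add: prod_eq_iff)
    then show False using bform_rt_nonzero [of j] by (simp add: bform_def)
  qed
qed

text \<open>
  The roots at indices \<open>k + n * d\<close> satisfy a recurrence in \<open>n\<close> with integer coefficients, so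
  each determinant with the root of index \<open>k\<close> is an integer multiple of the one at \<open>n = 1\<close>.
\<close>

lemma root_det_dvd_multiple:
  "root_det \<tau> (weight k) d dvd root_det \<tau> (weight k) (n * d)"
proof -
  let ?D = "root_det \<tau> (weight k) d"
  have "\<exists>z::int. rt (k + (n + 1) * d) + rt (k + (n - 1) * d) = real_of_int z *\<^sub>R rt (k + n * d)" for n
    by (rule rt_integral_sum [of "k + n * d" d]) (auto simp: algebra_simps)
  then obtain c :: "int \<Rightarrow> int" where
    c: "rt (k + (n + 1) * d) + rt (k + (n - 1) * d) = real_of_int (c n) *\<^sub>R rt (k + n * d)" for n
    by metis
  have "det2 (rt k) (rt (k + n * d)) \<in> range (\<lambda>z. real_of_int (?D * z))"
  proof (rule recurrence_closed [where c = c and f = "\<lambda>n. det2 (rt k) (rt (k + n * d))"])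
    fix n
    show "det2 (rt k) (rt (k + (n + 1) * d)) + det2 (rt k) (rt (k + (n - 1) * d)) =
        real_of_int (c n) *\<^sub>R det2 (rt k) (rt (k + n * d))"
      using arg_cong [OF c [of n], of "det2 (rt k)"] by (simp only: det2_simps real_scaleR_def)
  next
    show "det2 (rt k) (rt (k + 0 * d)) \<in> range (\<lambda>z. real_of_int (?D * z))"
      by (auto simp: det2_simps intro: image_eqI [of _ _ 0])
    show "det2 (rt k) (rt (k + 1 * d)) \<in> range (\<lambda>z. real_of_int (?D * z))"
      by (auto simp: det_rt intro: image_eqI [of _ _ 1])
  next
    fix z :: int and x y
    assume "x \<in> range (\<lambda>z. real_of_int (?D * z))" "y \<in> range (\<lambda>z. real_of_int (?D * z))"
    then obtain u v where "x = real_of_int (?D * u)" "y = real_of_int (?D * v)" by blast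
    then have "real_of_int z *\<^sub>R x - y = real_of_int (?D * (z * u - v))"
      by (simp add: algebra_simps)
    then show "real_of_int z *\<^sub>R x - y \<in> range (\<lambda>z. real_of_int (?D * z))" by blast
  qed
  then obtain z where "real_of_int (root_det \<tau> (weight k) (n * d)) = real_of_int (?D * z)"
    unfolding det_rt by blast
  then show ?thesis unfolding of_int_eq_iff by (rule dvdI)
qed

section \<open>Orbits of reflection groups as orbits of indices\<close>

definition roots_at :: "int set \<Rightarrow> (real \<times> real) set" where
  "roots_at K = rt ` K \<union> uminus ` rt ` K"

definition root_index :: "(real \<times> real) set \<Rightarrow> int set" where
  "root_index S = {k. rt k \<in> S \<or> - rt k \<in> S}"

lemma rt_in_roots_at: "rt k \<in> roots_at K \<longleftrightarrow> k \<in> K" "- rt k \<in> roots_at K \<longleftrightarrow> k \<in> K"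
  using rt_eq_iff rt_neq_minus by (auto simp: roots_at_def image_iff) (metis add.inverse_inverse)+

lemma roots_at_cases:
  assumes "v \<in> roots_at K"
  obtains k where "k \<in> K" "v = rt k" | k where "k \<in> K" "v = - rt k"
  using assms unfolding roots_at_def by auto

lemma roots_at_eq_iff: "roots_at K = roots_at L \<longleftrightarrow> K = L"
  using rt_in_roots_at(1) by (metis subsetI subset_antisym)

lemma root_index_simps:
  "root_index {} = {}" "root_index (insert (rt k) S) = insert k (root_index S)"
  "root_index (insert (- rt k) S) = insert k (root_index S)"
  unfolding root_index_def using rt_eq_iff rt_neq_minus
  by (auto) (metis add.inverse_inverse)+

lemma roots_at_mono: "K \<subseteq> L \<Longrightarrow> roots_at K \<subseteq> roots_at L"
  by (auto simp: roots_at_def)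

lemma subset_roots_at_index:
  assumes "S \<subseteq> roots_at UNIV" shows "S \<subseteq> roots_at (root_index S)"
  using assms by (fastforce simp: roots_at_def root_index_def)

lemma refl_on_roots_at:
  assumes closed: "\<And>j m. j \<in> root_index \<Gamma> \<Longrightarrow> m \<in> X \<Longrightarrow> 2 * j - m \<in> X"
    and "\<gamma> \<in> \<Gamma>" "\<Gamma> \<subseteq> roots_at UNIV" "v \<in> roots_at X"
  shows "refl a b \<gamma> v \<in> roots_at X"
proof -
  obtain j where j: "\<gamma> = rt j \<or> \<gamma> = - rt j" "j \<in> root_index \<Gamma>"
    using assms(2,3) subset_roots_at_index [OF assms(3)] by (blast elim: roots_at_cases)
  then have r: "refl a b \<gamma> = refl a b (rt j)" by (auto simp: fun_eq_iff refl_uminus)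
  from \<open>v \<in> roots_at X\<close> show ?thesis
    using closed [OF j(2)] by (auto elim!: roots_at_cases simp: r refl_uminus refl_rt rt_in_roots_at)
qed

lemma refl_roots_involution:
  assumes "\<gamma> \<in> roots_at UNIV"
  shows "refl a b \<gamma> (refl a b \<gamma> v) = v"
  using assms
  by (auto elim!: roots_at_cases
      simp: refl_uminus refl_involution bform_rt_nonzero)

lemma refl_group_bij:
  assumes "\<Gamma> \<subseteq> roots_at UNIV" and "g \<in> refl_group a b \<Gamma>"
  shows "bij g"
proof -
  have "refl a b ` \<Gamma> \<subseteq> carrier root_space_Bij"
  proof (rule image_subsetI)
    fix \<gamma> assume "\<gamma> \<in> \<Gamma>"
    then have "\<gamma> \<in> roots_at UNIV" using assms(1) by blast
    then show "refl a b \<gamma> \<in> carrier root_space_Bij"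
      unfolding root_space_Bij_carrier by (intro involution_bij refl_roots_involution)
  qed
  then show ?thesis
    using root_space.generate_in_carrier assms(2) unfolding refl_group_def
    by (metis root_space_Bij_carrier)
qed

lemma refl_group_on_roots_at:
  assumes closed: "\<And>j m. j \<in> root_index \<Gamma> \<Longrightarrow> m \<in> X \<Longrightarrow> 2 * j - m \<in> X"
    and \<Gamma>: "\<Gamma> \<subseteq> roots_at UNIV" and "g \<in> refl_group a b \<Gamma>" and "v \<in> roots_at X"
  shows "g v \<in> roots_at X"
  using assms(3,4) unfolding refl_group_def
proof (induction arbitrary: v rule: generate.induct)
  case one
  then show ?case by (simp add: root_space_Bij_one)
next
  case (incl h)
  then obtain \<gamma> where "\<gamma> \<in> \<Gamma>" and "h = refl a b \<gamma>" by auto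
  then show ?case using refl_on_roots_at [OF closed \<open>\<gamma> \<in> \<Gamma>\<close> \<Gamma>] incl by simp
next
  case (inv h)
  then obtain \<gamma> where "\<gamma> \<in> \<Gamma>" and h: "h = refl a b \<gamma>" by auto
  then have "inv\<^bsub>root_space_Bij\<^esub> h = h"
    unfolding h using \<Gamma>
    by (intro root_space_Bij_inv_involution refl_roots_involution) blast
  then show ?case using refl_on_roots_at [OF closed \<open>\<gamma> \<in> \<Gamma>\<close> \<Gamma>] inv h by simp
next
  case (eng g h)
  then have "bij g" "bij h"
    using refl_group_bij [OF \<Gamma>] by (auto simp: refl_group_def)
  then show ?case using eng by (simp add: root_space_Bij_mult)
qed

text \<open>
  Signs may be ignored because \<open>w\<^sub>\<alpha> \<alpha> = -\<alpha>\<close>; this is where \<open>S \<subseteq> \<Gamma>\<close> enters, since it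
  provides the reflection that negates each starting root.
\<close>

lemma orbit_refl_group:
  assumes \<Gamma>: "\<Gamma> \<subseteq> roots_at UNIV" and "S \<subseteq> \<Gamma>"
  shows "orbit (refl_group a b \<Gamma>) S = roots_at (refl_hull (root_index \<Gamma>) (root_index S))"
    (is "?O = roots_at ?H")
proof
  show "?O \<subseteq> roots_at ?H"
  proof
    fix v assume "v \<in> ?O"
    then obtain g s where v: "v = g s" "g \<in> refl_group a b \<Gamma>" "s \<in> S" unfolding orbit_def by auto
    have "s \<in> roots_at (root_index S)" using subset_roots_at_index assms v(3) by blast
    then have "s \<in> roots_at ?H"
      using roots_at_mono [of "root_index S" ?H] by (auto intro: refl_hull.base)
    then show "v \<in> roots_at ?H"
      using refl_group_on_roots_at [OF refl_hull.refl \<Gamma> v(2)] v(1) by simp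
  qed
next
  have step: "refl a b \<gamma> v \<in> ?O" if "\<gamma> \<in> \<Gamma>" "v \<in> ?O" for \<gamma> v
  proof -
    obtain g s where v: "v = g s" "g \<in> refl_group a b \<Gamma>" "s \<in> S"
      using \<open>v \<in> ?O\<close> unfolding orbit_def by auto
    have h: "refl a b \<gamma> \<in> refl_group a b \<Gamma>"
      unfolding refl_group_def using \<open>\<gamma> \<in> \<Gamma>\<close> by (intro generate.incl) auto
    have "refl a b \<gamma> \<otimes>\<^bsub>root_space_Bij\<^esub> g \<in> refl_group a b \<Gamma>"
      using h v(2) unfolding refl_group_def by (rule generate.eng)
    moreover have "(refl a b \<gamma> \<otimes>\<^bsub>root_space_Bij\<^esub> g) s = refl a b \<gamma> v"
      using refl_group_bij [OF \<Gamma>] h v by (simp add: root_space_Bij_mult)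
    ultimately show ?thesis using v(3) orbitI by metis
  qed
  have step_rt: "refl a b (rt j) v \<in> ?O" if "j \<in> root_index \<Gamma>" "v \<in> ?O" for j v
    using that step [of "rt j" v] step [of "- rt j" v] by (auto simp: root_index_def refl_uminus)
  have "S \<subseteq> ?O"
  proof
    fix s assume "s \<in> S"
    have "id \<in> refl_group a b \<Gamma>"
      using generate.one [of root_space_Bij] unfolding refl_group_def root_space_Bij_one .
    from orbitI [OF this \<open>s \<in> S\<close>] show "s \<in> ?O" by simp
  qed
  have "rt m \<in> ?O \<and> - rt m \<in> ?O" if "m \<in> ?H" for m
    using that
  proof induction
    case (base m)
    have "m \<in> root_index \<Gamma>" using base \<open>S \<subseteq> \<Gamma>\<close> by (auto simp: root_index_def)
    then have "v \<in> ?O \<Longrightarrow> refl a b (rt m) v \<in> ?O" for v by (rule step_rt)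
    from this [of "rt m"] this [of "- rt m"] show ?case
      using base \<open>S \<subseteq> ?O\<close> by (auto simp: root_index_def refl_rt refl_uminus)
  next
    case (refl j m)
    then show ?case
      using step_rt [of j "rt m"] step_rt [of j "- rt m"] by (simp add: refl_rt refl_uminus)
  qed
  then show "roots_at ?H \<subseteq> ?O" by (auto elim!: roots_at_cases)
qed

lemma simple_roots_subset: "{alpha1, alpha2} \<subseteq> roots_at UNIV"
  using rt_in_roots_at(1) [of 0 UNIV] rt_in_roots_at(2) [of "-1" UNIV] by (simp add: rt_0 rt_m1)

lemma orbit_weyl_group:
  "orbit (weyl_group a b) {alpha1} = roots_at {k. even k}"
  "orbit (weyl_group a b) {alpha2} = roots_at {k. odd k}"
proof -
  have W: "weyl_group a b = refl_group a b {alpha1, alpha2}"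
    using w1_refl [OF a_pos b_pos] w2_refl by (simp add: weyl_group_def refl_group_def)
  have simple: "alpha1 = rt 0" "alpha2 = - rt (-1)" by (simp_all add: rt_0 rt_m1)
  have I: "root_index {alpha1, alpha2} = {0, -1}" "root_index {alpha1} = {0}" "root_index {alpha2} = {-1}"
    unfolding simple root_index_simps by auto
  show "orbit (weyl_group a b) {alpha1} = roots_at {k. even k}"
    unfolding W using orbit_refl_group [OF simple_roots_subset, of "{alpha1}"]
    by (simp add: I refl_hull_simple)
  show "orbit (weyl_group a b) {alpha2} = roots_at {k. odd k}"
    unfolding W using orbit_refl_group [OF simple_roots_subset, of "{alpha2}"]
    by (simp add: I refl_hull_simple)
qed

lemma short_roots_eq: "a > b \<Longrightarrow> short_roots a b = roots_at {k. odd k}"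
  by (simp add: short_roots_def orbit_weyl_group)

lemma real_roots_eq: "real_roots a b = roots_at UNIV"
proof -
  have "roots_at {k. even k} \<union> roots_at {k. odd k} = roots_at ({k. even k} \<union> {k. odd k})"
    by (simp add: roots_at_def image_Un Un_ac)
  moreover have "{k. even k} \<union> {k. odd k} = (UNIV :: int set)" by auto
  ultimately show ?thesis unfolding real_roots_def orbit_weyl_group by simp
qed

lemma simple_reflections_rt:
  "w1 b (rt m) = - rt (- m)" "w2 a (rt m) = - rt (- 2 - m)"
  "w1 b (- v) = - w1 b v" "w2 a (- v) = - w2 a v"
proof -
  have "refl a b alpha2 = refl a b (rt (-1))" by (simp add: rt_m1 refl_uminus fun_eq_iff)
  then show "w1 b (rt m) = - rt (- m)" "w2 a (rt m) = - rt (- 2 - m)"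
    using refl_rt [of 0 m] refl_rt [of "-1" m] w1_refl [OF a_pos b_pos] w2_refl [of a b]
    by (simp_all add: rt_0 refl_uminus)
qed (simp_all add: w1_eq w2_eq)

lemma simple_reflections_bij: "bij (w1 b)" "bij (w2 a)"
  by (rule involution_bij, simp add: w1_eq w2_eq)+

lemma root_LL_eq: "root_LL a b j = rt (2 * j)"
proof -
  have "((w1 b \<circ> w2 a) [^]\<^bsub>root_space_Bij\<^esub> j) (rt (2 * 0)) = rt (2 * (0 + j))"
    by (rule int_pow_shift [where h = "\<lambda>m. rt (2 * m)"])
      (auto intro: bij_comp simple_reflections_bij simp: simple_reflections_rt algebra_simps)
  then show ?thesis by (simp add: root_LL_def rt_0)
qed

lemma root_SU_eq: "root_SU a b j = - rt (- 2 * j - 1)"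
proof -
  have "((w2 a \<circ> w1 b) [^]\<^bsub>root_space_Bij\<^esub> j) (- rt (- 2 * 0 - 1)) = - rt (- 2 * (0 + j) - 1)"
    by (rule int_pow_shift [where h = "\<lambda>m. - rt (- 2 * m - 1)"])
      (auto intro: bij_comp simple_reflections_bij simp: simple_reflections_rt algebra_simps)
  then show ?thesis by (simp add: root_SU_def rt_m1)
qed

lemma root_SL_eq: "root_SL a b j = rt (2 * j + 1)"
proof -
  have "((w1 b \<circ> w2 a) [^]\<^bsub>root_space_Bij\<^esub> j) (rt (2 * 0 + 1)) = rt (2 * (0 + j) + 1)"
    by (rule int_pow_shift [where h = "\<lambda>m. rt (2 * m + 1)"])
      (auto intro: bij_comp simple_reflections_bij simp: simple_reflections_rt algebra_simps)
  moreover have "w1 b alpha2 = rt 1"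
    using simple_reflections_rt(1) [of "-1"] simple_reflections_rt(3) [of alpha2] by (simp add: rt_m1)
  ultimately show ?thesis by (simp add: root_SL_def)
qed

section \<open>The subsystem and the lattice generated by a set of roots\<close>

lemma Phi_eq:
  assumes "\<Gamma> \<subseteq> roots_at UNIV"
  shows "Phi a b \<Gamma> = roots_at (refl_hull (root_index \<Gamma>) (root_index \<Gamma>))"
  unfolding Phi_def using assms by (rule orbit_refl_group) simp

lemma Phi_progression:
  assumes "\<Gamma> \<subseteq> roots_at UNIV" and "\<Gamma> \<noteq> {}"
  obtains k d where "d \<ge> 0" and "Phi a b \<Gamma> = roots_at (progression k d)"
proof -
  obtain k where "k \<in> root_index \<Gamma>"
    using assms subset_roots_at_index [OF assms(1)] by (auto simp: roots_at_def)
  then have "k \<in> refl_hull (root_index \<Gamma>) (root_index \<Gamma>)" by (rule refl_hull.base)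
  then show ?thesis
    using refl_closed_progression [OF refl_hull_self_closed] that Phi_eq [OF assms(1)] by metis
qed

lemma Delta_re_eq: "Delta_re a b \<Gamma> = roots_at (root_index (group_closure \<Gamma>))"
  unfolding Delta_re_def real_roots_eq by (auto simp: roots_at_def root_index_def)

lemma index_group_closure_iff: "k \<in> root_index (group_closure \<Gamma>) \<longleftrightarrow> rt k \<in> group_closure \<Gamma>"
  by (simp add: root_index_def)

text \<open>
  The lattice is closed under the reflections in the real roots it contains, because the coefficients
  are integers. Hence \<open>\<Delta>\<^sup>r\<^sup>e(\<Gamma>)\<close> is also given by an arithmetic progression of
  indices.
\<close>

lemma index_group_closure_refl:
  assumes "j \<in> root_index (group_closure \<Gamma>)" and "m \<in> root_index (group_closure \<Gamma>)"
  shows "2 * j - m \<in> root_index (group_closure \<Gamma>)"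
proof -
  obtain z :: int where "rt (j + (m - j)) + rt (j - (m - j)) = real_of_int z *\<^sub>R rt j"
    by (rule rt_integral_sum)
  then have "rt (2 * j - m) = real_of_int z *\<^sub>R rt j - rt m"
    by (simp add: algebra_simps)
  then show ?thesis using assms unfolding index_group_closure_iff
    by (auto intro: group_closure.diff group_closure_scaleR_int)
qed

lemma Phi_index_subset:
  assumes \<Gamma>: "\<Gamma> \<subseteq> roots_at UNIV" and Phi: "Phi a b \<Gamma> = roots_at K"
  shows "root_index \<Gamma> \<subseteq> K" and "K \<subseteq> root_index (group_closure \<Gamma>)"
proof -
  have K: "K = refl_hull (root_index \<Gamma>) (root_index \<Gamma>)"
    using Phi Phi_eq [OF \<Gamma>] by (simp add: roots_at_eq_iff)
  show "root_index \<Gamma> \<subseteq> K" unfolding K by (auto intro: refl_hull.base)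
  have "root_index \<Gamma> \<subseteq> root_index (group_closure \<Gamma>)"
    unfolding root_index_def using group_closure.base [of _ \<Gamma>] by blast
  then show "K \<subseteq> root_index (group_closure \<Gamma>)"
    unfolding K using index_group_closure_refl by (intro refl_hull_subset) blast+
qed

text \<open>
  The determinant with the root of index \<open>k\<close> is a linear functional. It maps the generators into
  the multiples of one integer, hence the whole lattice.
\<close>

lemma det_group_closure:
  assumes \<Gamma>: "\<Gamma> \<subseteq> roots_at (progression k d)" and "v \<in> group_closure \<Gamma>"
  shows "\<exists>z::int. det2 (rt k) v = z * root_det \<tau> (weight k) d"
  using assms(2)
proof induction
  case (base v)
  show ?case
  proof (cases "v = 0")
    case True
    then show ?thesis by (auto simp: det2_simps intro: exI [of _ 0])
  next
    case False
    then have "v \<in> roots_at (progression k d)" using base \<Gamma> by auto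
    then obtain j where j: "d dvd j - k" "v = rt j \<or> v = - rt j"
      by (auto elim: roots_at_cases)
    then obtain n where "j = k + n * d" by (metis dvdE mult.commute add_diff_cancel_left' diff_add_cancel add.commute)
    moreover obtain z where "root_det \<tau> (weight k) (n * d) = root_det \<tau> (weight k) d * z"
      using root_det_dvd_multiple [of k d n] by (rule dvdE)
    ultimately have "det2 (rt k) (rt j) = root_det \<tau> (weight k) d * z" by (simp add: det_rt)
    then have "det2 (rt k) v = z * root_det \<tau> (weight k) d \<or>
        det2 (rt k) v = (- z) * root_det \<tau> (weight k) d"
      using j(2) by (auto simp: det2_simps)
    then show ?thesis by blast
  qed
next
  case (diff u v)
  then obtain y z :: int where "det2 (rt k) u = y * root_det \<tau> (weight k) d"
    "det2 (rt k) v = z * root_det \<tau> (weight k) d" by blast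
  then have "det2 (rt k) (u - v) = (y - z) * root_det \<tau> (weight k) d"
    by (simp add: det2_simps algebra_simps)
  then show ?case by blast
qed

text \<open>
  The last conclusion is the obstruction to enlarging \<open>\<Phi>(\<Gamma>)\<close>: evaluating the functional of the
  preceding lemma at the root of index \<open>k + d'\<close> of the lattice.
\<close>

lemma Delta_re_progression:
  assumes \<Gamma>: "\<Gamma> \<subseteq> roots_at UNIV" and Phi: "Phi a b \<Gamma> = roots_at (progression k d)" and "d \<ge> 0"
  obtains d' where "d' \<ge> 0" and "d' dvd d" and "Delta_re a b \<Gamma> = roots_at (progression k d')"
    and "root_det \<tau> (weight k) d dvd root_det \<tau> (weight k) d'"
proof -
  have sub: "progression k d \<subseteq> root_index (group_closure \<Gamma>)"
    using Phi_index_subset [OF \<Gamma> Phi] by simp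
  then have "k \<in> root_index (group_closure \<Gamma>)" by auto
  then obtain d' where "d' \<ge> 0" and A: "root_index (group_closure \<Gamma>) = progression k d'"
    using refl_closed_progression [OF index_group_closure_refl] by metis
  have "k + d \<in> progression k d'" using sub unfolding A by (rule subsetD) simp
  then have "d' dvd d" by simp
  have "\<Gamma> \<subseteq> roots_at (progression k d)"
    using subset_roots_at_index [OF \<Gamma>] roots_at_mono [OF Phi_index_subset(1) [OF \<Gamma> Phi]] by simp
  moreover have "k + d' \<in> root_index (group_closure \<Gamma>)" unfolding A by simp
  ultimately obtain z :: int where "det2 (rt k) (rt (k + d')) = z * root_det \<tau> (weight k) d"
    using det_group_closure unfolding index_group_closure_iff by blast
  then have "root_det \<tau> (weight k) d' = z * root_det \<tau> (weight k) d"
    unfolding det_rt by (simp flip: of_int_mult)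
  then show ?thesis using that \<open>d' \<ge> 0\<close> \<open>d' dvd d\<close> A Delta_re_eq by simp
qed

section \<open>Bases and types of subsystems\<close>

lemma det_rt_nonneg: "i \<le> j \<Longrightarrow> det2 (rt i) (rt j) \<ge> 0"
  using det_rt_pos [of i j] by (cases "i = j") (simp_all add: det2_simps)

text \<open>
  The coordinates with respect to \<open>\<beta>\<^bsub>k+d\<^esub>\<close> and \<open>-\<beta>\<^sub>k\<close> are quotients of determinants by Cramer's
  rule. They are integers by the divisibility of determinants along a progression, and their common
  sign only depends on the side of the gap between \<open>k\<close> and \<open>k + d\<close> on which \<open>j\<close> lies.
\<close>

lemma progression_combination:
  assumes "d > 0" and "d dvd j - k"
  shows "\<exists>m n :: nat. rt j = real m *\<^sub>R rt (k + d) + real n *\<^sub>R (- rt k) \<or>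
    rt j = - (real m *\<^sub>R rt (k + d) + real n *\<^sub>R (- rt k))"
proof -
  define D where "D = root_det \<tau> (weight k) d"
  have "D > 0" unfolding D_def using root_det_pos [OF tau_ge weight_pos \<open>d > 0\<close>] .
  obtain n where n: "j = k + n * d"
    using assms(2) by (metis dvdE mult.commute add_diff_cancel_left' diff_add_cancel add.commute)
  obtain p where "root_det \<tau> (weight k) (n * d) = D * p"
    using root_det_dvd_multiple [of k d n] unfolding D_def by (rule dvdE)
  then have p: "det2 (rt k) (rt j) = D * p" by (simp add: n det_rt)
  have D: "det2 (rt k) (rt (k + d)) = D" unfolding det_rt D_def ..
  (* The same divisibility, along the reversed progression that starts at k + d. *)
  obtain q where q: "det2 (rt (k + d)) (rt j) = D * q"
  proof -
    have "root_det \<tau> (weight (k + d)) (- d) = - D"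
      using det_rt [of "k + d" "- d"] D det2_swap [of "rt (k + d)" "rt k"]
      by (simp flip: of_int_minus)
    moreover have "root_det \<tau> (weight (k + d)) (- d) dvd root_det \<tau> (weight (k + d)) ((1 - n) * (- d))"
      by (rule root_det_dvd_multiple)
    ultimately have "D dvd root_det \<tau> (weight (k + d)) ((1 - n) * (- d))" by simp
    then obtain q where "root_det \<tau> (weight (k + d)) ((1 - n) * (- d)) = D * q" by (rule dvdE)
    moreover have "j = k + d + (1 - n) * (- d)" by (simp add: n algebra_simps)
    ultimately have "det2 (rt (k + d)) (rt j) = D * q"
      using det_rt [of "k + d" "(1 - n) * (- d)"] by simp
    then show ?thesis by (rule that)
  qed
  have "real_of_int D *\<^sub>R rt j = (- (D * q)) *\<^sub>R rt k + (D * p) *\<^sub>R rt (k + d)"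
    using det2_cramer [of "rt k" "rt (k + d)" "rt j"] D p q det2_swap [of "rt j" "rt (k + d)"] by simp
  also have "\<dots> = real_of_int D *\<^sub>R (real_of_int p *\<^sub>R rt (k + d) + real_of_int q *\<^sub>R (- rt k))"
    by (simp add: algebra_simps)
  finally have j: "rt j = real_of_int p *\<^sub>R rt (k + d) + real_of_int q *\<^sub>R (- rt k)"
    using \<open>D > 0\<close> by (metis scaleR_left_imp_eq of_int_0_eq_iff less_irrefl)
  show ?thesis
  proof (cases "n \<ge> 1")
    case True
    then have "k + d \<le> j" "k \<le> j" using \<open>d > 0\<close> unfolding n by simp_all
    then have "real_of_int D * q \<ge> 0" "real_of_int D * p \<ge> 0"
      using det_rt_nonneg [of k j] det_rt_nonneg [of "k + d" j] p q by simp_all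
    then have "p \<ge> 0" "q \<ge> 0" using \<open>D > 0\<close> by (simp_all add: zero_le_mult_iff)
    then have "rt j = real (nat p) *\<^sub>R rt (k + d) + real (nat q) *\<^sub>R (- rt k)" using j by simp
    then show ?thesis by blast
  next
    case False
    then have "j \<le> k" using \<open>d > 0\<close> unfolding n by (simp add: mult_le_0_iff)
    then have "det2 (rt j) (rt (k + d)) \<ge> 0" "det2 (rt j) (rt k) \<ge> 0"
      using det_rt_nonneg [of j k] det_rt_nonneg [of j "k + d"] \<open>d > 0\<close> by simp_all
    then have "real_of_int D * q \<le> 0" "real_of_int D * p \<le> 0"
      using p q det2_swap [of "rt k" "rt j"] det2_swap [of "rt (k + d)" "rt j"] by simp_all
    then have "p \<le> 0" "q \<le> 0" using \<open>D > 0\<close> by (simp_all add: mult_le_0_iff)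
    then have "rt j = - (real (nat (- p)) *\<^sub>R rt (k + d) + real (nat (- q)) *\<^sub>R (- rt k))"
      using j by simp
    then show ?thesis by blast
  qed
qed

lemma has_basis_swap:
  assumes "has_basis a b \<Psi> u v" shows "has_basis a b \<Psi> v u"
proof -
  note basis = assms [unfolded has_basis_def]
  note combination = basis [THEN conjunct2, THEN conjunct2, THEN conjunct2]
  have swapped: "\<exists>m n :: nat. w = real m *\<^sub>R v + real n *\<^sub>R u \<or> w = - (real m *\<^sub>R v + real n *\<^sub>R u)"
    if "w \<in> \<Psi>" for w
  proof -
    from bspec [OF combination that] obtain m n :: nat where
      "w = real m *\<^sub>R u + real n *\<^sub>R v \<or> w = - (real m *\<^sub>R u + real n *\<^sub>R v)"
      by (elim exE)
    then have "w = real n *\<^sub>R v + real m *\<^sub>R u \<or> w = - (real n *\<^sub>R v + real m *\<^sub>R u)"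
      by (simp only: add.commute)
    then show ?thesis by blast
  qed
  have pair: "{v, u} = {u, v}" by blast
  show ?thesis
    unfolding has_basis_def pair
    by (intro conjI ballI basis [THEN conjunct1] basis [THEN conjunct2, THEN conjunct1]
        basis [THEN conjunct2, THEN conjunct2, THEN conjunct1] swapped)
qed

lemma Phi_pair: "Phi a b {rt (k + d), - rt k} = roots_at (progression k d)"
proof -
  have "{rt (k + d), - rt k} \<subseteq> roots_at UNIV" by (simp add: rt_in_roots_at)
  then show ?thesis
    by (simp add: Phi_eq root_index_simps refl_hull_pair insert_commute [of "k + d"])
qed

lemma progression_has_basis:
  assumes "d > 0"
  shows "has_basis a b (roots_at (progression k d)) (rt (k + d)) (- rt k)"
proof -
  have "\<exists>m n :: nat. v = real m *\<^sub>R rt (k + d) + real n *\<^sub>R (- rt k) \<or>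
      v = - (real m *\<^sub>R rt (k + d) + real n *\<^sub>R (- rt k))"
    if "v \<in> roots_at (progression k d)" for v
  proof -
    obtain j where j: "d dvd j - k" "v = rt j \<or> v = - rt j"
      using \<open>v \<in> _\<close> by (auto elim: roots_at_cases)
    then show ?thesis
      using progression_combination [OF assms j(1)] by (metis add.inverse_inverse)
  qed
  then show ?thesis
    using Phi_pair [of k d] unfolding has_basis_def Phi_def by (auto simp: rt_in_roots_at)
qed

lemma Phi_subsystem_progression: "Phi_subsystem a b (roots_at (progression k d))"
  unfolding Phi_subsystem_def real_roots_eq
  using Phi_pair [of k d] by (intro exI [of _ "{rt (k + d), - rt k}"]) (simp add: rt_in_roots_at)

text \<open>
  The basis root \<open>\<alpha>\<^sup>S\<^sup>U\<^sub>r\<close> is the negative of the chain member of index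
  \<open>-2r - 1\<close>, and \<open>\<alpha>\<^sup>S\<^sup>L\<^bsub>d-r-1\<^esub>\<close> is the chain member \<open>2d\<close> places later.
\<close>

lemma type_II_S_iff:
  "type_II_S a b d r \<Psi> \<longleftrightarrow>
    0 \<le> r \<and> r < d \<and> \<Psi> = roots_at (progression (- 2 * r - 1) (2 * d))"
proof -
  have SL: "root_SL a b (d - r - 1) = rt (- 2 * r - 1 + 2 * d)"
    by (simp add: root_SL_eq algebra_simps)
  have Psi: "\<Psi> = roots_at (progression (- 2 * r - 1) (2 * d))"
    if "has_basis a b \<Psi> (root_SU a b r) (root_SL a b (d - r - 1))"
  proof -
    have "\<Psi> = Phi a b {root_SU a b r, root_SL a b (d - r - 1)}"
      using that by (simp add: has_basis_def Phi_def)
    then show ?thesis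
      using Phi_pair [of "- 2 * r - 1" "2 * d"] by (simp add: SL root_SU_eq insert_commute)
  qed
  have "has_basis a b (roots_at (progression (- 2 * r - 1) (2 * d)))
      (root_SU a b r) (root_SL a b (d - r - 1))" if "d > 0"
    unfolding SL root_SU_eq
    by (rule has_basis_swap, rule progression_has_basis) (use that in simp)
  then show ?thesis
    using Psi Phi_subsystem_progression unfolding type_II_S_def by fastforce
qed

text \<open>
  Here \<open>\<alpha>\<^sup>S\<^sup>U\<^bsub>e-s\<^esub>\<close> is the negative of the chain member \<open>2e + 1\<close> places before
  \<open>\<alpha>\<^sup>L\<^sup>L\<^sub>s\<close>, so the difference of the progression is odd and both parities of indices occur.
\<close>

lemma type_II_LS_progression:
  assumes "- e \<le> s" and "s \<le> e"
  shows "type_II_LS a b e s (roots_at (progression (2 * s) (2 * e + 1)))"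
proof -
  define k where "k = 2 * s - (2 * e + 1)"
  have "progression (2 * s) (2 * e + 1) = progression k (2 * e + 1)"
    by (rule progression_cong) (simp add: k_def)
  moreover have "root_LL a b s = rt (k + (2 * e + 1))" "root_SU a b (e - s) = - rt k"
    by (simp_all add: root_LL_eq root_SU_eq k_def algebra_simps)
  ultimately show ?thesis
    using assms progression_has_basis [of "2 * e + 1" k] Phi_subsystem_progression
    unfolding type_II_LS_def by simp
qed

section \<open>Comparing the two subsystems\<close>

text \<open>
  The unit \<open>weight k = 1\<close> left over by the arithmetic means that \<open>b = 1\<close> and that the root of index
  \<open>k\<close> is short.
\<close>

lemma proper_Delta_re:
  assumes \<Gamma>: "\<Gamma> \<subseteq> roots_at UNIV" and Phi: "Phi a b \<Gamma> = roots_at (progression k d)" and "d \<ge> 0"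
    and "a \<ge> b" and neq: "Delta_re a b \<Gamma> \<noteq> Phi a b \<Gamma>"
  obtains d' where "b = 1" and "odd k" and "odd d'" and "d' > 0" and "d = 2 * d'"
    and "a > 4 \<Longrightarrow> d' = 1" and "Delta_re a b \<Gamma> = roots_at (progression k d')"
proof -
  obtain d' where d': "d' \<ge> 0" "d' dvd d" "Delta_re a b \<Gamma> = roots_at (progression k d')"
    "root_det \<tau> (weight k) d dvd root_det \<tau> (weight k) d'"
    by (rule Delta_re_progression [OF \<Gamma> Phi \<open>d \<ge> 0\<close>])
  have "d' \<noteq> d" using neq d'(3) Phi by auto
  then have *: "weight k = 1 \<and> odd d' \<and> d = 2 * d' \<and> (\<tau> \<ge> 3 \<longrightarrow> d' = 1)"
    using root_det_dvd_imp [OF tau_ge weight_pos d'(1,2) \<open>d \<ge> 0\<close>] d'(4) by blast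
  have "b = 1 \<and> odd k"
    using * \<open>a \<ge> b\<close> b_pos ab_ge_4 by (auto simp: weight_def split: if_splits)
  moreover have "d' > 0" using * d'(1) by (metis even_zero le_less)
  moreover have "d' = 1" if "a > 4"
    using * that \<open>b = 1 \<and> odd k\<close> unfolding \<tau>_def by simp
  ultimately show ?thesis using that [of d'] * d'(3) by blast
qed

lemma even_root_between:
  assumes "b = 1" and "rt (k - 1) \<in> group_closure \<Gamma>" and "rt (k + 1) \<in> group_closure \<Gamma>" and "even k"
  shows "rt k \<in> group_closure \<Gamma>"
proof -
  have "cartan k = 1" unfolding cartan_def using assms(1,4) by simp
  then show ?thesis
    using rt_rec [of k] group_closure_add [OF assms(3,2)] by simp
qed

text \<open>
  In the affine case \<open>H(4,1)\<close> the roots are affine linear functions of the index on each parity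
  class. A long root is the sum of any two short ones placed symmetrically about it, so a
  progression of short roots with gap \<open>2d\<close>, \<open>d\<close> odd, generates the long roots halfway.
\<close>

lemma rt_even_as_sum:
  assumes "a = 4" and "b = 1" and "even j" and "odd d"
  shows "rt j = rt (j - d) + rt (j + d)"
proof -
  have "\<tau> = 2" unfolding \<tau>_def using assms(1,2) by simp
  obtain m n where "j = 2 * m" "d = 2 * n + 1" using assms(3,4) by (auto elim!: evenE oddE)
  moreover have "rt (2 * i) = (2 * i + 1, 4 * i)" "rt (2 * i + 1) = (i + 1, 2 * i + 1)" for i
    using root_det_even [of 2 1 "i + 1"] root_det_even [of 2 4 i]
      root_det_odd [of 2 1 i] root_det_odd [of 2 4 i]
    unfolding rt_def \<open>\<tau> = 2\<close> by (simp_all add: cheb_two algebra_simps assms(1,2))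
  from this(1) [of m] this(2) [of "m - n - 1"] this(2) [of "m + n"]
  have "rt (2 * m) = rt (2 * (m - n - 1) + 1) + rt (2 * (m + n) + 1)"
    by (simp add: prod_eq_iff)
  ultimately show ?thesis by (simp add: algebra_simps)
qed

end

text \<open>
  It remains to match parameters. In case (ii) the progression of indices starts at \<open>-2r - 1\<close> and its
  gap \<open>2d\<close> is halved; the new member \<open>2(e - r)\<close> is even, and moving it by multiples of \<open>2d\<close> gives
  the index \<open>2s\<close> with \<open>s \<equiv> e - r\<close>.
\<close>

theorem theorem4p13:
  fixes a b :: nat and \<Gamma> :: "(real \<times> real) set"
  assumes "a > 0" and "b > 0" and "a \<ge> b" and "a * b \<ge> 4"
    and "\<Gamma> \<subseteq> real_roots a b" and "\<Gamma> \<noteq> {}"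
  shows
    "(a > 4 \<and> b = 1 \<and> Phi a b \<Gamma> = short_roots a b \<longrightarrow>
        Delta_re a b \<Gamma> = real_roots a b \<and> real_roots a b \<noteq> Phi a b \<Gamma>)
     \<and>
     (\<forall>d e r :: int.
        a = 4 \<and> b = 1 \<and> d = 2 * e + 1 \<and> type_II_S a b d r (Phi a b \<Gamma>) \<longrightarrow>
        Delta_re a b \<Gamma> \<noteq> Phi a b \<Gamma> \<and>
        (\<exists>s :: int. [s = e - r] (mod d) \<and> - e \<le> s \<and> s \<le> e \<and>
           type_II_LS a b e s (Delta_re a b \<Gamma>)))
     \<and>
     (\<not> (a > 4 \<and> b = 1 \<and> Phi a b \<Gamma> = short_roots a b) \<and>
      \<not> (a = 4 \<and> b = 1 \<and> (\<exists>d r :: int. odd d \<and> type_II_S a b d r (Phi a b \<Gamma>))) \<longrightarrow>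
        Delta_re a b \<Gamma> = Phi a b \<Gamma>)"
proof -
  interpret rank2 a b using assms by unfold_locales
  have \<Gamma>: "\<Gamma> \<subseteq> roots_at UNIV" using assms(5) by (simp add: real_roots_eq)
  have odds: "odd k \<Longrightarrow> progression k 2 = {k. odd k}"
    for k :: int
    by auto
  show ?thesis
  proof (intro conjI allI impI)
    assume "a > 4 \<and> b = 1 \<and> Phi a b \<Gamma> = short_roots a b"
    then have "b = 1" and "a > b" and short: "Phi a b \<Gamma> = short_roots a b" by linarith+
    have Phi: "Phi a b \<Gamma> = roots_at {k. odd k}"
      using short short_roots_eq [OF \<open>a > b\<close>] by (rule trans)
    have odd: "rt k \<in> group_closure \<Gamma>" if "odd k" for k
      using Phi_index_subset(2) [OF \<Gamma> Phi] that by (auto simp flip: index_group_closure_iff)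
    have "rt k \<in> group_closure \<Gamma>" for k
      using odd [of k] odd [of "k - 1"] odd [of "k + 1"] even_root_between [OF \<open>b = 1\<close>, of k]
      by auto
    then have "root_index (group_closure \<Gamma>) = UNIV" by (auto simp: index_group_closure_iff)
    then show "Delta_re a b \<Gamma> = real_roots a b" by (simp add: Delta_re_eq real_roots_eq)
    show "real_roots a b \<noteq> Phi a b \<Gamma>" unfolding Phi real_roots_eq roots_at_eq_iff by auto
  next
    fix d e r :: int
    assume asm: "a = 4 \<and> b = 1 \<and> d = 2 * e + 1 \<and> type_II_S a b d r (Phi a b \<Gamma>)"
    then have ab: "a = 4" "b = 1" and d: "d = 2 * e + 1" "0 \<le> r" "r < d"
      and Phi: "Phi a b \<Gamma> = roots_at (progression (- 2 * r - 1) (2 * d))"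
      unfolding type_II_S_iff by blast+
    define j where "j = - 2 * r - 1 + d"
    have "even j" "odd d" by (simp_all add: j_def d(1))
    then have j_sum: "rt j = rt (j - d) + rt (j + d)" by (rule rt_even_as_sum [OF ab])
    have "j - d \<in> progression (- 2 * r - 1) (2 * d)" "j + d \<in> progression (- 2 * r - 1) (2 * d)"
      by (simp_all add: j_def)
    then have "rt j \<in> group_closure \<Gamma>"
      using Phi_index_subset(2) [OF \<Gamma> Phi] unfolding j_sum
      by (auto simp flip: index_group_closure_iff intro!: group_closure_add)
    then have mem: "rt j \<in> Delta_re a b \<Gamma>"
      unfolding Delta_re_def real_roots_eq by (simp add: rt_in_roots_at)
    have "j \<notin> progression (- 2 * r - 1) (2 * d)" using d by (auto simp: j_def dest: zdvd_imp_le)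
    then show neq: "Delta_re a b \<Gamma> \<noteq> Phi a b \<Gamma>" using mem unfolding Phi by (auto simp: rt_in_roots_at)
    have Delta: "Delta_re a b \<Gamma> = roots_at (progression (- 2 * r - 1) d)"
    proof -
      have "2 * d \<ge> 0" using d by simp
      then obtain d' where "2 * d = 2 * d'" "Delta_re a b \<Gamma> = roots_at (progression (- 2 * r - 1) d')"
        using proper_Delta_re [OF \<Gamma> Phi _ \<open>a \<ge> b\<close> neq] by metis
      then show ?thesis by simp
    qed
    obtain s where s: "[s = e - r] (mod d)" "- e \<le> s" "s \<le> e"
      using exists_balanced_residue [of e "e - r"] d by auto
    have "d dvd s - (e - r)" using s(1) by (simp add: cong_iff_dvd_diff)
    then have "d dvd 2 * (s - (e - r)) + d" by (intro dvd_add dvd_mult dvd_refl)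
    then have "d dvd 2 * s - (- 2 * r - 1)" by (simp add: d(1) algebra_simps)
    then have "progression (- 2 * r - 1) d = progression (2 * s) d"
      by (rule progression_cong [symmetric])
    then have "type_II_LS a b e s (Delta_re a b \<Gamma>)"
      using type_II_LS_progression [OF s(2,3)] Delta d(1) by simp
    with s show "\<exists>s. [s = e - r] (mod d) \<and> - e \<le> s \<and> s \<le> e \<and> type_II_LS a b e s (Delta_re a b \<Gamma>)"
      by blast
  next
    assume not_exceptional: "\<not> (a > 4 \<and> b = 1 \<and> Phi a b \<Gamma> = short_roots a b) \<and>
      \<not> (a = 4 \<and> b = 1 \<and> (\<exists>d r :: int. odd d \<and> type_II_S a b d r (Phi a b \<Gamma>)))"
    show "Delta_re a b \<Gamma> = Phi a b \<Gamma>"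
    proof (rule ccontr)
      assume neq: "Delta_re a b \<Gamma> \<noteq> Phi a b \<Gamma>"
      obtain k d where "d \<ge> 0" and Phi: "Phi a b \<Gamma> = roots_at (progression k d)"
        using Phi_progression [OF \<Gamma> \<open>\<Gamma> \<noteq> {}\<close>] by blast
      obtain d' where d': "b = 1" "odd k" "odd d'" "d' > 0" "d = 2 * d'" "a > 4 \<Longrightarrow> d' = 1"
        using proper_Delta_re [OF \<Gamma> Phi \<open>d \<ge> 0\<close> \<open>a \<ge> b\<close> neq] by metis
      have "a \<ge> 4" using \<open>b = 1\<close> \<open>a * b \<ge> 4\<close> by simp
      then consider "a > 4" | "a = 4" by linarith
      then show False
      proof cases
        case 1
        then have "Phi a b \<Gamma> = short_roots a b"
          unfolding Phi using d' odds [of k] short_roots_eq by simp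
        then show False using 1 d'(1) not_exceptional by simp
      next
        case 2
        obtain n where "k = 2 * n + 1" using \<open>odd k\<close> by (rule oddE)
        moreover define i where "i = - n - 1"
        ultimately have k: "k = - 2 * i - 1" by simp
        (* The progression has many starting points; the reduction selects the one in the range that
           the definition of the type demands. *)
        define r where "r = i mod d'"
        have "2 * d' dvd k - (- 2 * r - 1)"
        proof
          have "i = d' * (i div d') + r" by (simp add: r_def)
          then show "k - (- 2 * r - 1) = 2 * d' * (- (i div d'))" unfolding k by (simp add: algebra_simps)
        qed
        then have "progression k d = progression (- 2 * r - 1) (2 * d')"
          unfolding d'(5) by (rule progression_cong)
        then have "type_II_S a b d' r (Phi a b \<Gamma>)"
          unfolding type_II_S_iff Phi r_def using \<open>d' > 0\<close> by simp
        then show False using 2 d' not_exceptional by blast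
      qed
    qed
  qed
qed

end
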